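(* Let $3\leq k<\ell$ be integers with $k\nmid \ell$ and $\ell\ge 20k^2$. If $2\nmid \frac{k}{\gcd(k,\ell)}$, then $\gamma(C^k_\ell)\le \frac13$.
   Context: A $k$-uniform hypergraph $G$ has a finite vertex set $V(G)$ and an edge set $E(G)$ consisting of $k$-element subsets of $V(G)$. The codegree of a $(k-1)$-subset $S\subseteq V(G)$ is $|\{v\in V(G): S\cup\{v\}\in E(G)\}|$, where only $k$-sets $S\cup\{v\}$ count, and $\delta_{k-1}(G)$ is the minimum codegree over all $(k-1)$-subsets of $V(G)$. For a $k$-uniform hypergraph $F$, $\mathrm{ex}_{k-1}(n,F)$ is the largest value of $\delta_{k-1}(G)$ over $k$-uniform hypergraphs $G$ on $n$ vertices containing no copy of $F$ (as a not necessarily induced subhypergraph). The codegree Turán density of $F$ is $\gamma(F)=\lim_{n\to\infty}\mathrm{ex}_{k-1}(n,F)/n$ (this limit is known to exist). For $\ell\ge k+1$, the tight cycle $C^k_\ell$ is the $k$-uniform hypergraph on $\ell$ distinct vertices $v_1,\dots,v_\ell$ with edges $\{v_i,v_{i+1},\dots,v_{i+k-1}\}$ for all $i\in\{1,\dots,\ell\}$, indices modulo $\ell$. *)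

theory Defs
  imports Complex_Main
begin

type_synonym 'a hypergraph = "'a set \<times> 'a set set"

abbreviation verts :: "'a hypergraph \<Rightarrow> 'a set" where
  "verts G \<equiv> fst G"

abbreviation edges :: "'a hypergraph \<Rightarrow> 'a set set" where
  "edges G \<equiv> snd G"

definition uniform_hypergraph :: "nat \<Rightarrow> 'a hypergraph \<Rightarrow> bool" where
  "uniform_hypergraph k G \<longleftrightarrow>
     finite (verts G) \<and> (\<forall>e\<in>edges G. e \<subseteq> verts G \<and> card e = k)"

text \<open>For a \<open>k\<close>-uniform \<open>G\<close> and \<open>card S = k - 1\<close>, vertices \<open>v \<in> S\<close> do not contribute,
  since then \<open>insert v S = S\<close> has fewer than \<open>k\<close> elements.\<close>

definition codegree :: "'a hypergraph \<Rightarrow> 'a set \<Rightarrow> nat" where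
  "codegree G S = card {v \<in> verts G. insert v S \<in> edges G}"

text \<open>Meaningful only if \<open>G\<close> has at least \<open>k - 1\<close> vertices (otherwise the minimum ranges
  over the empty set); smaller graphs do not affect the limit below.\<close>

definition min_codegree :: "nat \<Rightarrow> 'a hypergraph \<Rightarrow> nat" where
  "min_codegree k G = Min (codegree G ` {S. S \<subseteq> verts G \<and> card S = k - 1})"

definition contains_copy :: "'a hypergraph \<Rightarrow> 'b hypergraph \<Rightarrow> bool" where
  "contains_copy G F \<longleftrightarrow>
     (\<exists>f. inj_on f (verts F) \<and> f ` verts F \<subseteq> verts G \<and> (\<forall>e\<in>edges F. f ` e \<in> edges G))"

text \<open>All notions are invariant under isomorphism, so it suffices to let the host
  hypergraphs have natural numbers as vertices.\<close>

definition ex_codegree :: "nat \<Rightarrow> nat \<Rightarrow> 'b hypergraph \<Rightarrow> nat" where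
  "ex_codegree k n F =
     Max {min_codegree k G | G :: nat hypergraph.
            uniform_hypergraph k G \<and> card (verts G) = n \<and> \<not> contains_copy G F}"

definition codegree_turan_density :: "nat \<Rightarrow> 'b hypergraph \<Rightarrow> real" where
  "codegree_turan_density k F = lim (\<lambda>n. real (ex_codegree k n F) / real n)"

text \<open>The vertices \<open>v\<^sub>1, \<dots>, v\<^sub>\<ell>\<close> are the residues \<open>0, \<dots>, \<ell> - 1\<close>; intended for \<open>\<ell> \<ge> k + 1\<close>.\<close>

definition tight_cycle :: "nat \<Rightarrow> nat \<Rightarrow> nat hypergraph" where
  "tight_cycle k l = ({..<l}, (\<lambda>i. (\<lambda>j. (i + j) mod l) ` {..<k}) ` {..<l})"

lemma uniform_tight_cycle:
  assumes "k < l"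
  shows "uniform_hypergraph k (tight_cycle k l)"
proof -
  have "inj_on (\<lambda>j. (i + j) mod l) {..<k}" for i
  proof (rule inj_onI)
    fix a b assume ab: "a \<in> {..<k}" "b \<in> {..<k}" "(i + a) mod l = (i + b) mod l"
    then have "int (i + a) mod int l = int (i + b) mod int l"
      by (simp only: of_nat_mod [symmetric])
    then have "int l dvd int (i + a) - int (i + b)"
      by (simp only: mod_eq_dvd_iff)
    then have "int l dvd int a - int b"
      by simp
    moreover have "\<bar>int a - int b\<bar> < int l"
      using ab assms by auto
    ultimately show "a = b"
      using dvd_imp_le_int[of "int a - int b" "int l"] by fastforce
  qed
  then show ?thesis
    using assms by (auto simp: uniform_hypergraph_def tight_cycle_def card_image)
qed

text \<open>The maximum defining \<^const>\<open>ex_codegree\<close> is over a finite nonempty set.\<close>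

lemma
  fixes F :: "'b hypergraph"
  assumes "k \<ge> 1" "n \<ge> k - 1" "edges F \<noteq> {}"
  defines "A \<equiv> {min_codegree k G | G :: nat hypergraph.
            uniform_hypergraph k G \<and> card (verts G) = n \<and> \<not> contains_copy G F}"
  shows finite_min_codegrees: "finite A" and min_codegrees_nonempty: "A \<noteq> {}"
proof -
  have "min_codegree k G \<le> n"
    if G: "uniform_hypergraph k G" "card (verts G) = n" for G :: "nat hypergraph"
  proof -
    have fin: "finite (verts G)" using G by (simp add: uniform_hypergraph_def)
    obtain S where S: "S \<subseteq> verts G" "card S = k - 1"
      using G(2) assms(2) obtain_subset_with_card_n[of "k - 1" "verts G"] by auto
    have "min_codegree k G \<le> codegree G S"
      unfolding min_codegree_def using fin S by (intro Min_le) auto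
    also have "\<dots> \<le> n"
      unfolding codegree_def using G(2) card_mono[OF fin, of "{v \<in> verts G. insert v S \<in> edges G}"] by auto
    finally show ?thesis .
  qed
  then have "A \<subseteq> {..n}" unfolding A_def by auto
  then show "finite A" using finite_subset by blast
  have "uniform_hypergraph k ({..<n}, {})" "card (verts ({..<n}, {})) = n"
    "\<not> contains_copy ({..<n}, {}) F"
    using assms(3) by (auto simp: uniform_hypergraph_def contains_copy_def)
  then show "A \<noteq> {}" unfolding A_def by blast
qed

end

theory Submission
  imports Defs "HOL-Library.FuncSet" "HOL-Combinatorics.Permutations"
begin

text \<open>
  Closed tight walks are easier to find than cycles. If every hypergraph of minimum codegree above a
  third of its order contains a closed tight walk of length \<open>l\<close>, that is, a homomorphic image of
  the tight cycle, then the density is at most \<open>1 / 3\<close>: in a large host of codegree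
  \<open>(1 / 3 + 2 \<epsilon>) n\<close>, most samples of a bounded number of vertices keep a codegree above a third, so a
  fixed closed walk occurs in a positive proportion of the samples
  (\<open>most_samples_keep_codegree\<close>), and a blow-up of the walk contains the cycle
  (\<open>dense_set_of_functions_contains_box\<close>, \<open>copy_of_cycle_in_box\<close>). The same sampling shows that the
  limit in the definition of the density exists.

  A tight walk can circle around in an edge, exchanging one vertex per round for another one.
  Whenever it returns to the edge it started from, it has permuted the vertices of that edge. It can
  be closed after \<open>l\<close> steps if the permutation is the rotation by \<open>l\<close>, for some ordering of the
  edge; this permutation has \<open>gcd k l\<close> cycles, all of length \<open>q = k / gcd k l\<close>. If \<open>e - u\<close> and
  \<open>e - v\<close> have a common neighbour, then \<open>u\<close> and \<open>v\<close> can be swapped in three rounds; call \<open>u\<close> and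
  \<open>v\<close> adjacent then. Codegrees above a third force an adjacent pair among any three vertices of \<open>e\<close>.
  So if there is no closed walk, then each edge consists of exactly two classes of mutually
  adjacent vertices, since otherwise all pairs could be swapped cheaply enough
  (\<open>adj_trans\<close>, \<open>ex_not_adj\<close>), and for the same reason the classes are preserved
  when one vertex is exchanged (\<open>adj_move\<close>).

  The core is to show that an edge with class sizes \<open>(a, b)\<close>, \<open>a \<ge> 2\<close>, forces another one with
  class sizes \<open>(a - 2, b + 2)\<close> (\<open>class_descent\<close>). To this end, consider a set \<open>R\<close> of \<open>k - 2\<close> vertices.
  Each \<open>R + x\<close> inherits a partition with a distinguished active part, which the next vertex joins,
  and neighbours of \<open>R + x\<close> have a type determined by that of \<open>x\<close>. As two of any three
  neighbourhoods meet, few types occur at \<open>R\<close>. If \<open>R\<close> arises from an edge by deleting two vertices of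
  the same class, exactly two types occur, and they are complementary
  (\<open>pure_other_trace\<close>, \<open>traces_disjoint\<close>); the second one provides the new edge.

  An empty class is impossible, so all class sizes are odd, \<open>k\<close> is even, and every odd number
  below \<open>k\<close> is a class size. As \<open>q\<close> is odd, some edge has a class of size \<open>q\<close>. Then the
  rotation can be arranged to respect the two classes, and it is a product of available swaps after
  all (\<open>no_edge\<close>).
\<close>

section \<open>Tight walks read in blocks\<close>

lemma add_mod_cancel:
  fixes a b k m :: nat
  assumes "(m + a) mod k = (m + b) mod k" "a < k" "b < k"
  shows "a = b"
proof -
  have "a = b" if "(m + b) mod k = (m + a) mod k" "b < k" "a \<le> b" for a b :: nat
  proof -
    have "k dvd b - a" using that mod_eq_dvd_iff_nat[of "m + a" "m + b" k] by simp
    then show ?thesis using that by (auto dest: dvd_imp_le)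
  qed
  then show ?thesis using assms by (metis nat_le_linear)
qed

locale equicardinal_family =
  fixes E :: "'a set set" and k :: nat
  assumes card_edge: "e \<in> E \<Longrightarrow> card e = k" and k_pos: "0 < k"
begin

text \<open>A tight walk is read in consecutive blocks of \<open>k\<close> vertices; a block is an ordering
  \<open>s 0, \<dots>, s (k - 1)\<close> of an edge. If consecutive blocks differ in at most one position,
  then every window of \<open>k\<close> consecutive vertices is one of the two edges involved. Blocks are
  total functions of which only the values below \<open>k\<close> matter, so that changing one vertex is
  simply a function update.\<close>

definition tight_step :: "(nat \<Rightarrow> 'a) \<Rightarrow> (nat \<Rightarrow> 'a) \<Rightarrow> bool" where
  "tight_step s s' \<longleftrightarrow> s ` {..<k} \<in> E \<and> s' ` {..<k} \<in> E \<and> (\<exists>i<k. \<exists>x. s' = s(i := x))"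

definition closed_tight_walk :: "nat \<Rightarrow> (nat \<Rightarrow> 'a) \<Rightarrow> bool" where
  "closed_tight_walk l f \<longleftrightarrow> (\<forall>i<l. (\<lambda>j. f ((i + j) mod l)) ` {..<k} \<in> E)"

text \<open>The number \<open>c\<close> counts blocks. The quantification over all orderings of \<open>e\<close> is what makes
  swaps composable: after one swap the next one is available again.\<close>

definition swappable :: "nat \<Rightarrow> 'a set \<Rightarrow> 'a \<Rightarrow> 'a \<Rightarrow> bool" where
  "swappable c e u v \<longleftrightarrow>
     (\<forall>s i j. s ` {..<k} = e \<longrightarrow> i < k \<longrightarrow> j < k \<longrightarrow> s i = u \<longrightarrow> s j = v \<longrightarrow>
        (tight_step ^^ c) s (s(i := v, j := u)))"

lemma swappableD:
  "swappable c e u v \<Longrightarrow> s ` {..<k} = e \<Longrightarrow> i < k \<Longrightarrow> j < k \<Longrightarrow> s i = u \<Longrightarrow> s j = v \<Longrightarrow>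
     (tight_step ^^ c) s (s(i := v, j := u))"
  unfolding swappable_def by blast

lemma finite_edge: "e \<in> E \<Longrightarrow> finite e"
  using card_edge k_pos by (metis card.infinite less_numeral_extra(3))

lemma inj_on_ordering: "s ` {..<k} \<in> E \<Longrightarrow> inj_on s {..<k}"
  by (rule eq_card_imp_inj_on) (use card_edge in auto)

lemma tight_stepI:
  "s ` {..<k} \<in> E \<Longrightarrow> i < k \<Longrightarrow> s(i := x) ` {..<k} \<in> E \<Longrightarrow> tight_step s (s(i := x))"
  unfolding tight_step_def by blast

lemma tight_steps_idle: "s ` {..<k} \<in> E \<Longrightarrow> (tight_step ^^ r) s s"
proof (induction r)
  case (Suc r)
  have "tight_step s s"
    unfolding tight_step_def using Suc.prems k_pos by (metis fun_upd_triv)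
  then show ?case using Suc by (meson relpowp_Suc_I)
qed simp

lemma tight_steps_idle_more:
  assumes "(tight_step ^^ r) s s'" "s' ` {..<k} \<in> E" "r \<le> r'"
  shows "(tight_step ^^ r') s s'"
  using relpowp_trans[OF assms(1) tight_steps_idle[OF assms(2), of "r' - r"]] assms(3) by simp

lemma image_update:
  assumes "inj_on s {..<k}" "i < k"
  shows "s(i := x) ` {..<k} = insert x (s ` {..<k} - {s i})"
proof -
  have "s(i := x) ` {..<k} = insert x (s ` ({..<k} - {i}))"
    using assms(2) by (auto simp: image_iff)
  also have "s ` ({..<k} - {i}) = s ` {..<k} - {s i}"
    using assms by (subst inj_on_image_set_diff[OF assms(1)]) auto
  finally show ?thesis .
qed

lemma image_swap:
  assumes "i < k" "j < k" "s i = u" "s j = v"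
  shows "s(i := v, j := u) ` {..<k} = s ` {..<k}"
proof -
  have "s(i := v, j := u) = s \<circ> transpose i j"
    using assms by (auto simp: transpose_def fun_eq_iff)
  moreover have "transpose i j ` {..<k} = {..<k}"
    using assms by (intro permutes_image permutes_swap_id) auto
  ultimately show ?thesis by (metis image_comp)
qed

lemma swappable_mono:
  assumes "swappable c e u v" "c \<le> c'" "e \<in> E"
  shows "swappable c' e u v"
  unfolding swappable_def
proof (intro allI impI)
  fix s i j assume s: "s ` {..<k} = e" "i < k" "j < k" "s i = u" "s j = v"
  have "s(i := v, j := u) ` {..<k} = e"
    using image_swap[OF s(2-5)] s(1) by (rule trans)
  then show "(tight_step ^^ c') s (s(i := v, j := u))"
    using assms(3) by (intro tight_steps_idle_more[OF swappableD[OF assms(1) s] _ assms(2)]) blast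
qed

lemma swappable_refl: "e \<in> E \<Longrightarrow> swappable c e u u"
  unfolding swappable_def by (auto simp: tight_steps_idle fun_upd_idem)

lemma swappable_sym:
  assumes "e \<in> E" "swappable c e u v" shows "swappable c e v u"
  unfolding swappable_def
proof (intro allI impI)
  fix s i j assume s: "s ` {..<k} = e" "i < k" "j < k" "s i = v" "s j = u"
  show "(tight_step ^^ c) s (s(i := u, j := v))"
  proof (cases "i = j")
    case True
    then show ?thesis using s assms(1) by (auto simp: tight_steps_idle fun_upd_idem)
  next
    case False
    then show ?thesis using assms(2) s unfolding swappable_def by (metis fun_upd_twist)
  qed
qed

text \<open>The edges \<open>e\<close>, \<open>e - u + w\<close> and \<open>e - v + w\<close> lie in the set \<open>e + w\<close> of size \<open>k + 1\<close>.
  Going once around this triangle, with \<open>w\<close> taking the place of \<open>u\<close>, then \<open>u\<close> that of \<open>v\<close>, then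
  \<open>v\<close> that of \<open>w\<close>, exchanges \<open>u\<close> and \<open>v\<close>.\<close>

lemma swappable_common_neighbour:
  assumes e: "e \<in> E" "u \<noteq> v" "u \<in> e" "v \<in> e"
    and w: "insert w (e - {u}) \<in> E" "insert w (e - {v}) \<in> E"
  shows "swappable 3 e u v"
  unfolding swappable_def
proof (intro allI impI)
  have fin: "finite e" "card e = k" using finite_edge card_edge e by auto
  have we: "w \<notin> e"
  proof
    assume "w \<in> e"
    have "w = u"
    proof (rule ccontr)
      assume "w \<noteq> u"
      then have "insert w (e - {u}) = e - {u}" using \<open>w \<in> e\<close> by blast
      then show False using card_edge[OF w(1)] fin e k_pos by simp
    qed
    then have "insert w (e - {v}) = e - {v}" using e by blast
    then show False using card_edge[OF w(2)] fin e k_pos by simp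
  qed
  fix s i j assume s: "s ` {..<k} = e" "i < k" "j < k" "s i = u" "s j = v"
  have inj: "inj_on s {..<k}" using s e inj_on_ordering by auto
  have ij: "i \<noteq> j" using s e by auto
  let ?s1 = "s(i := w)" and ?s2 = "s(i := w, j := u)" and ?s3 = "s(i := v, j := u)"
  have 1: "?s1 ` {..<k} = insert w (e - {u})"
    using image_update[OF inj s(2)] s by simp
  then have inj1: "inj_on ?s1 {..<k}" using w inj_on_ordering by auto
  have 2: "?s2 ` {..<k} = insert w (e - {v})"
    using image_update[OF inj1 s(3), of u] 1 ij s e we by auto
  have 3: "?s3 ` {..<k} = e"
    using image_swap[OF s(2-5)] s(1) by (rule trans)
  have "tight_step s ?s1"
    by (rule tight_stepI) (use 1 w e s in \<open>blast, blast, metis\<close>)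
  moreover have "tight_step ?s1 ?s2"
    by (rule tight_stepI) (use 1 2 w s in \<open>metis, blast, metis\<close>)
  moreover have "tight_step ?s2 ?s3"
  proof -
    have "?s3 = ?s2(i := v)" using ij by (auto simp: fun_eq_iff)
    moreover have "tight_step ?s2 (?s2(i := v))"
      by (rule tight_stepI) (use 2 3 w s e(1) calculation in \<open>metis, blast, metis\<close>)
    ultimately show ?thesis by metis
  qed
  ultimately have "(tight_step ^^ Suc (Suc (Suc 0))) s ?s3"
    by (meson relpowp_0_I relpowp_Suc_I)
  then show "(tight_step ^^ 3) s ?s3" by (simp add: numeral_3_eq_3)
qed

text \<open>This is the identity \<open>(u w) = (u v) (v w) (u v)\<close> of transpositions.\<close>

lemma swappable_trans:
  assumes "e \<in> E" "v \<in> e" and uv: "swappable c e u v" and vw: "swappable c' e v w"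
  shows "swappable (2 * c + c') e u w"
proof (cases "u = v \<or> v = w \<or> u = w")
  case True
  then show ?thesis
    using swappable_mono[OF uv, of "2 * c + c'"] swappable_mono[OF vw, of "2 * c + c'"] assms(1)
      swappable_refl[OF assms(1), of "2 * c + c'" u] by auto
next
  case False
  show ?thesis
    unfolding swappable_def
  proof (intro allI impI)
    fix s i j assume s: "s ` {..<k} = e" "i < k" "j < k" "s i = u" "s j = w"
    obtain m where m: "m < k" "s m = v" using s assms(2) by auto
    have ne: "i \<noteq> j" "i \<noteq> m" "j \<noteq> m" using False s m by auto
    let ?s1 = "s(i := v, m := u)"
    let ?s2 = "?s1(i := w, j := v)"
    let ?s3 = "?s2(j := u, m := v)"
    have im1: "?s1 ` {..<k} = e"
      by (rule trans[OF image_swap]) (use s m in auto)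
    have s1: "?s1 i = v" "?s1 j = w" using s ne by auto
    have im2: "?s2 ` {..<k} = e"
      by (rule trans[OF image_swap[OF s(2,3) s1] im1])
    have s2: "?s2 j = v" "?s2 m = u" using s ne by auto
    have "(tight_step ^^ c) s ?s1" by (rule swappableD[OF uv s(1,2) m(1) s(4) m(2)])
    moreover have "(tight_step ^^ c') ?s1 ?s2"
      by (rule swappableD[OF vw im1 s(2,3) s1])
    moreover have "(tight_step ^^ c) ?s2 ?s3"
      by (rule swappableD[OF swappable_sym[OF assms(1) uv] im2 s(3) m(1) s2])
    moreover have "?s3 = s(i := w, j := u)"
      using ne m s by (auto simp: fun_eq_iff)
    ultimately have "(tight_step ^^ (c + c' + c)) s (s(i := w, j := u))"
      by (metis relpowp_trans)
    then show "(tight_step ^^ (2 * c + c')) s (s(i := w, j := u))"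
      by (simp add: mult_2 add.commute add.left_commute)
  qed
qed

text \<open>A swap in the edge \<open>e - v + w\<close> is conjugated by the single step from \<open>e\<close> to that edge,
  under which \<open>w\<close> plays the part of \<open>v\<close>.\<close>

lemma swappable_pullback:
  assumes e: "e \<in> E" "v \<in> e" and e': "insert w (e - {v}) \<in> E" and "w \<notin> e"
    and ut: "u \<in> e" "t \<in> e" "u \<noteq> t"
    and sw: "swappable c (insert w (e - {v})) (if u = v then w else u) (if t = v then w else t)"
  shows "swappable (c + 2) e u t"
  unfolding swappable_def
proof (intro allI impI)
  fix s i j assume s: "s ` {..<k} = e" "i < k" "j < k" "s i = u" "s j = t"
  obtain m where m: "m < k" "s m = v" using s e by auto
  have inj: "inj_on s {..<k}" using s e inj_on_ordering by auto
  have ij: "i \<noteq> j" using s ut by auto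
  have iu: "i = m \<longleftrightarrow> u = v" "j = m \<longleftrightarrow> t = v"
    using inj s m by (auto dest: inj_onD)
  let ?a = "if u = v then w else u" and ?b = "if t = v then w else t"
  let ?s0 = "s(m := w)"
  let ?s1 = "?s0(i := ?b, j := ?a)"
  let ?s2 = "s(i := t, j := u)"
  let ?n = "transpose i j m"
  have im0: "?s0 ` {..<k} = insert w (e - {v})"
    using image_update[OF inj m(1)] s m by simp
  have st: "?s0 i = ?a" "?s0 j = ?b" using s iu m ij by auto
  have im1: "?s1 ` {..<k} = insert w (e - {v})"
    by (rule trans[OF image_swap[OF s(2,3) st] im0])
  have im2: "?s2 ` {..<k} = e" by (rule trans[OF image_swap[OF s(2-5)] s(1)])
  have "tight_step s ?s0"
    by (rule tight_stepI) (use im0 e' e s m in \<open>metis, blast, metis\<close>)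
  moreover have "(tight_step ^^ c) ?s0 ?s1"
    by (rule swappableD[OF sw im0 s(2,3) st])
  moreover have "tight_step ?s1 ?s2"
  proof -
    have "?s2 = ?s1(?n := v)"
      using iu ij s m by (auto simp: fun_eq_iff transpose_def)
    moreover have "?n < k" using s m by (simp add: transpose_def)
    moreover have "tight_step ?s1 (?s1(?n := v))"
      by (rule tight_stepI) (use im1 im2 e' e(1) calculation in \<open>metis, blast, metis\<close>)
    ultimately show ?thesis by metis
  qed
  ultimately show "(tight_step ^^ (c + 2)) s ?s2"
    by (metis (no_types) relpowp_Suc_I relpowp_Suc_I2 add_2_eq_Suc')
qed

text \<open>Swaps inside the fibres of a labelling generate every permutation that respects the
  labelling, at the cost of at most one swap per position.\<close>

lemma tight_steps_permutation:
  assumes e: "e \<in> E" "s ` {..<k} = e"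
    and sw: "\<And>u t. u \<in> e \<Longrightarrow> t \<in> e \<Longrightarrow> cls u = cls t \<Longrightarrow> swappable c e u t"
    and p: "p permutes {..<k}" "\<And>i. i < k \<Longrightarrow> cls (s (p i)) = cls (s i)"
  shows "(tight_step ^^ (c * k)) s (s \<circ> p)"
proof -
  have "(tight_step ^^ (c * card X)) s (s \<circ> p)"
    if "finite X" "X \<subseteq> {..<k}" "p permutes X" "s ` {..<k} = e"
      "\<And>i. i < k \<Longrightarrow> cls (s (p i)) = cls (s i)" for X p s
    using that
  proof (induction X arbitrary: s p rule: finite_induct)
    case empty
    then show ?case by simp
  next
    case (insert x X)
    let ?t = "transpose x (p x)" and ?q = "transpose x (p x) \<circ> p"
    let ?s = "s \<circ> ?t"
    have x: "x < k" "p x < k"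
      using insert.prems(1,2) permutes_in_image[of p "insert x X" x] by auto
    have q: "?q permutes X" using insert.prems by (intro permutes_insert_lemma) auto
    have s_eq: "?s = s(x := s (p x), p x := s x)"
      by (auto simp: fun_eq_iff transpose_def)
    have im: "?s ` {..<k} = e" using image_swap[OF x refl refl, of s] insert.prems(3) s_eq by metis
    have cls_t: "cls (?s i) = cls (s i)" if "i < k" for i
      using insert.prems(4)[OF x(1)] that by (auto simp: transpose_def)
    have cls_q: "cls (?s (?q i)) = cls (?s i)" if "i < k" for i
    proof -
      have "cls (?s (?q i)) = cls (s (p i))" by (simp add: transpose_def)
      then show ?thesis using cls_t[OF that] insert.prems(4)[OF that] by simp
    qed
    have "(tight_step ^^ (c * card X)) ?s (?s \<circ> ?q)"
    proof (rule insert.IH)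
      show "X \<subseteq> {..<k}" using insert.prems(1) by blast
    qed (fact q im cls_q)+
    moreover have "?s \<circ> ?q = s \<circ> p" by (auto simp: fun_eq_iff)
    moreover have "(tight_step ^^ c) s ?s"
      using sw[of "s x" "s (p x)"] insert.prems(3,4) x
      unfolding swappable_def s_eq by (metis imageI lessThan_iff)
    ultimately have "(tight_step ^^ (c + c * card X)) s (s \<circ> p)"
      by (metis relpowp_trans)
    then show ?case
      unfolding card_insert_disjoint[OF insert.hyps(1,2)] mult_Suc_right .
  qed
  from this[OF finite_lessThan subset_refl p(1) e(2) p(2)] show ?thesis by simp
qed

text \<open>A window that starts inside block \<open>b\<close> sees each position once, the late ones in block \<open>b\<close>
  and the early ones in block \<open>b + 1\<close>. As the blocks differ in one position \<open>i\<^sub>0\<close> only, it is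
  the vertex set of one of them, depending on the side on which \<open>i\<^sub>0\<close> lies.\<close>

lemma window_of_blocks:
  assumes "\<And>b. tight_step (g b) (g (Suc b))"
  shows "(\<lambda>j. g ((i + j) div k) ((i + j) mod k)) ` {..<k} \<in> E"
proof -
  let ?b = "i div k" and ?m = "i mod k"
  obtain i0 x where i0: "i0 < k" "g (Suc ?b) = (g ?b)(i0 := x)"
    and E: "g ?b ` {..<k} \<in> E" "g (Suc ?b) ` {..<k} \<in> E"
    using assms[of ?b] unfolding tight_step_def by blast
  have m: "?m < k" using k_pos by simp
  have shift: "(\<lambda>j. (?m + j) mod k) ` {..<k} = {..<k}"
  proof -
    have inj: "inj_on (\<lambda>j. (?m + j) mod k) {..<k}"
      by (rule inj_onI, erule add_mod_cancel) auto
    show ?thesis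
      by (rule endo_inj_surj) (use k_pos inj in auto)
  qed
  have val: "g ((i + j) div k) ((i + j) mod k) =
     (if ?m \<le> i0 then g ?b ((?m + j) mod k) else g (Suc ?b) ((?m + j) mod k))" if "j < k" for j
  proof -
    have ij: "i + j = k * ?b + (?m + j)" by simp
    have md: "(i + j) mod k = (?m + j) mod k" by (metis mod_add_left_eq)
    show ?thesis
    proof (cases "?m + j < k")
      case True
      then have "(i + j) div k = ?b"
        by (intro div_nat_eqI) (use ij mult_Suc_right[of k ?b] in linarith)+
      then show ?thesis using True md i0 by auto
    next
      case False
      then have dv: "(i + j) div k = Suc ?b"
        using that m
        by (intro div_nat_eqI) (use ij mult_Suc_right[of k ?b] mult_Suc_right[of k "Suc ?b"] in linarith)+
      have "?m + j - k < k" using that m by linarith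
      then have "(?m + j) mod k = ?m + j - k" using False by (simp add: le_mod_geq)
      then have "(?m + j) mod k < ?m" using that False by linarith
      then show ?thesis using dv md i0 by auto
    qed
  qed
  show ?thesis
  proof (cases "?m \<le> i0")
    case True
    then have "(\<lambda>j. g ((i + j) div k) ((i + j) mod k)) ` {..<k} = g ?b ` (\<lambda>j. (?m + j) mod k) ` {..<k}"
      using val by (auto simp: image_iff)
    then show ?thesis using E shift by simp
  next
    case False
    then have "(\<lambda>j. g ((i + j) div k) ((i + j) mod k)) ` {..<k} = g (Suc ?b) ` (\<lambda>j. (?m + j) mod k) ` {..<k}"
      using val by (auto simp: image_iff)
    then show ?thesis using E shift by simp
  qed
qed

text \<open>After \<open>l\<close> vertices, position \<open>l mod k\<close> of a block is reached. If from some block on all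
  blocks equal the first one rotated by \<open>l\<close>, then the vertices from there on repeat those at
  the start, and the walk closes up.\<close>

lemma closed_tight_walk_of_rotation:
  assumes steps: "(tight_step ^^ r) s s'" and E: "s ` {..<k} \<in> E" "s' ` {..<k} \<in> E"
    and rot: "\<And>i. i < k \<Longrightarrow> s' ((i + l) mod k) = s i"
    and l: "r \<le> l div k" "k < l"
  shows "\<exists>f. closed_tight_walk l f \<and> f ` {..<l} \<subseteq> \<Union>E"
proof -
  obtain h where h: "h 0 = s" "h r = s'" "\<And>i. i < r \<Longrightarrow> tight_step (h i) (h (Suc i))"
    using steps by (auto simp: relpowp_fun_conv)
  define g where "g b = (if b \<le> r then h b else s')" for b
  have step: "tight_step (g b) (g (Suc b))" for b
  proof (cases "b < r")
    case True then show ?thesis using h by (simp add: g_def)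
  next
    case False
    then have "g b = s'" "g (Suc b) = s'" using h by (auto simp: g_def)
    then show ?thesis using tight_steps_idle[OF E(2), of 1] by (simp only: relpowp_1)
  qed
  define f where "f i = g (i div k) (i mod k)" for i
  have f_low: "f i = s i" if "i < k" for i using that h by (simp add: f_def g_def)
  have f_high: "f (l + i) = s i" if "i < k" for i
  proof -
    have "r \<le> (l + i) div k" using l(1) div_le_mono[of l "l + i" k] by linarith
    then have "g ((l + i) div k) = s'" using h by (auto simp: g_def)
    then show ?thesis using rot[OF that] by (simp add: f_def add.commute)
  qed
  have fmod: "f ((i + j) mod l) = f (i + j)" if "i < l" "j < k" for i j
  proof (cases "i + j < l")
    case False
    then have "(i + j) mod l = i + j - l" using that l by (simp add: mod_if)
    moreover have "i + j - l < k" using that l by linarith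
    ultimately show ?thesis using f_low f_high[of "i + j - l"] False by simp
  qed simp
  have win: "(\<lambda>j. f (i + j)) ` {..<k} \<in> E" for i
    using window_of_blocks[of g i, OF step] by (simp add: f_def)
  have "closed_tight_walk l f"
    unfolding closed_tight_walk_def
  proof (intro allI impI)
    fix i assume "i < l"
    then have "(\<lambda>j. f ((i + j) mod l)) ` {..<k} = (\<lambda>j. f (i + j)) ` {..<k}"
      using fmod by (intro image_cong) auto
    then show "(\<lambda>j. f ((i + j) mod l)) ` {..<k} \<in> E" using win by simp
  qed
  moreover have "f i \<in> \<Union>E" for i
  proof -
    have "f (i + 0) \<in> (\<lambda>j. f (i + j)) ` {..<k}" using k_pos by (intro imageI) simp
    then show ?thesis using win[of i] by (intro UnionI) auto
  qed
  ultimately show ?thesis by blast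
qed

lemma rotation_permutes:
  "(\<lambda>i. if i < k then (i + a) mod k else i) permutes {..<k}"
proof (rule bij_imp_permutes)
  have "inj_on (\<lambda>i. if i < k then (i + a) mod k else i) {..<k}"
    by (rule inj_onI, simp) (metis add_mod_cancel add.commute)
  then show "bij_betw (\<lambda>i. if i < k then (i + a) mod k else i) {..<k} {..<k}"
    using k_pos by (intro bij_betw_imageI endo_inj_surj) auto
qed auto

lemma closed_tight_walk_of_swaps:
  assumes e: "e \<in> E" "s ` {..<k} = e"
    and sw: "\<And>u t. u \<in> e \<Longrightarrow> t \<in> e \<Longrightarrow> cls u = cls t \<Longrightarrow> swappable c e u t"
    and cls: "\<And>i. i < k \<Longrightarrow> cls (s ((i + l) mod k)) = cls (s i)"
    and l: "c * k \<le> l div k" "k < l"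
  shows "\<exists>f. closed_tight_walk l f \<and> f ` {..<l} \<subseteq> \<Union>E"
proof -
  let ?rot = "\<lambda>i. if i < k then (i + l) mod k else i"
  define p where "p = inv ?rot"
  have rot: "?rot permutes {..<k}" by (rule rotation_permutes)
  have p: "p permutes {..<k}" unfolding p_def by (rule permutes_inv[OF rot])
  have p_rot: "p ((i + l) mod k) = i" if "i < k" for i
    using permutes_inverses(2)[OF rot, of i] that by (simp add: p_def)
  have rot_p: "(p i + l) mod k = i" if "i < k" for i
    using permutes_inverses(1)[OF rot, of i] permutes_in_image[OF p, of i] that
    by (simp add: p_def)
  have "cls (s (p i)) = cls (s i)" if "i < k" for i
    using cls[of "p i"] rot_p[OF that] permutes_in_image[OF p, of i] that by simp
  then have "(tight_step ^^ (c * k)) s (s \<circ> p)"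
    using tight_steps_permutation[OF e sw p] by blast
  moreover have "(s \<circ> p) ` {..<k} \<in> E"
    using e permutes_image[OF p] by (metis image_comp)
  ultimately show ?thesis
    using e p_rot l by (intro closed_tight_walk_of_rotation[where r = "c * k" and s' = "s \<circ> p"]) auto
qed

lemma ex_ordering:
  assumes "e \<in> E" shows "\<exists>s. s ` {..<k} = e"
proof -
  have "card {..<k} = card e" using card_edge[OF assms] by simp
  then obtain s where "bij_betw s {..<k} e"
    using finite_same_card_bij[of "{..<k}" e] finite_edge[OF assms] by blast
  then show ?thesis unfolding bij_betw_def by blast
qed

lemma closed_tight_walk_if_all_swappable:
  assumes e: "e \<in> E" and sw: "\<And>u t. u \<in> e \<Longrightarrow> t \<in> e \<Longrightarrow> swappable c e u t"
    and l: "c * k \<le> l div k" "k < l"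
  shows "\<exists>f. closed_tight_walk l f \<and> f ` {..<l} \<subseteq> \<Union>E"
proof -
  obtain s where "s ` {..<k} = e" using ex_ordering[OF e] by blast
  from closed_tight_walk_of_swaps[OF e this sw refl l, of "\<lambda>_. ()"] show ?thesis by simp
qed

lemma card_multiples_below:
  assumes "d dvd (m::nat)" "0 < d" shows "card {i. i < m \<and> d dvd i} = m div d"
proof -
  have "{i. i < m \<and> d dvd i} = (\<lambda>j. d * j) ` {..<m div d}"
    using assms by (auto simp: dvd_def)
  then show ?thesis using assms by (simp add: card_image inj_on_def)
qed

text \<open>The rotation by \<open>l\<close> of the positions modulo \<open>k\<close> consists of \<open>gcd k l\<close> cycles of length
  \<open>k div gcd k l\<close> each. If \<open>C\<close> is placed on one of these cycles, then the rotation maps \<open>C\<close> and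
  \<open>e - C\<close> to themselves, and swaps inside \<open>C\<close> and inside \<open>e - C\<close> suffice.\<close>

lemma closed_tight_walk_if_class_swappable:
  assumes e: "e \<in> E" and C: "C \<subseteq> e" "card C = k div gcd k l"
    and sw: "\<And>u t. u \<in> e \<Longrightarrow> t \<in> e \<Longrightarrow> u \<in> C \<longleftrightarrow> t \<in> C \<Longrightarrow> swappable c e u t"
    and l: "c * k \<le> l div k" "k < l"
  shows "\<exists>f. closed_tight_walk l f \<and> f ` {..<l} \<subseteq> \<Union>E"
proof -
  let ?d = "gcd k l"
  let ?I = "{i. i < k \<and> ?d dvd i}"
  have fin: "finite e" using finite_edge[OF e] .
  have cI: "card ?I = card C" using C k_pos by (subst card_multiples_below) auto
  obtain s1 where s1: "bij_betw s1 ?I C"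
    using finite_same_card_bij[OF _ _ cI] finite_subset[OF C(1) fin] by auto
  have "card ({..<k} - ?I) = k - card C" using cI by (subst card_Diff_subset) auto
  also have "\<dots> = card (e - C)"
    using card_edge[OF e] finite_subset[OF C(1) fin] C(1) by (simp add: card_Diff_subset)
  finally obtain s2 where s2: "bij_betw s2 ({..<k} - ?I) (e - C)"
    using finite_same_card_bij[of "{..<k} - ?I" "e - C"] fin by auto
  define s where "s i = (if i \<in> ?I then s1 i else s2 i)" for i
  have mem: "s i \<in> C \<longleftrightarrow> i \<in> ?I" if "i < k" for i
    using that bij_betwE[OF s1] bij_betwE[OF s2] by (auto simp: s_def)
  have "s ` ?I = C" using s1 by (auto simp: s_def bij_betw_def)
  moreover have "s ` ({..<k} - ?I) = e - C" using s2 by (auto simp: s_def bij_betw_def)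
  moreover have "s ` {..<k} = s ` ?I \<union> s ` ({..<k} - ?I)"
    unfolding image_Un[symmetric] by (rule arg_cong[where f = "image s"]) auto
  ultimately have im: "s ` {..<k} = e" using C(1) by (simp only: Un_Diff_cancel) blast
  have "(i + l) mod k \<in> ?I \<longleftrightarrow> i \<in> ?I" if "i < k" for i
  proof -
    have "?d dvd (i + l) mod k \<longleftrightarrow> ?d dvd i"
      by (simp add: dvd_mod_iff dvd_add_left_iff)
    then show ?thesis using k_pos that by auto
  qed
  then have "(s ((i + l) mod k) \<in> C) = (s i \<in> C)" if "i < k" for i
    using mem[OF that] mem[of "(i + l) mod k"] that k_pos by simp
  then show ?thesis
    using closed_tight_walk_of_swaps[OF e im, of "\<lambda>u. u \<in> C"] sw l by blast
qed

end

section \<open>Locally two-coloured complete graphs\<close>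

lemma two_of_three_meet:
  assumes "finite V" "A \<subseteq> V" "B \<subseteq> V" "C \<subseteq> V"
    and "card V < 3 * card A" "card V < 3 * card B" "card V < 3 * card C"
  shows "A \<inter> B \<noteq> {} \<or> A \<inter> C \<noteq> {} \<or> B \<inter> C \<noteq> {}"
proof (rule ccontr)
  assume "\<not> ?thesis"
  then have disj: "A \<inter> B = {}" "(A \<union> B) \<inter> C = {}" by auto
  have fin: "finite A" "finite B" "finite C" using assms finite_subset by blast+
  have "card (A \<union> B \<union> C) = card A + card B + card C"
    using disj fin by (simp add: card_Un_disjoint)
  moreover have "card (A \<union> B \<union> C) \<le> card V" using assms by (intro card_mono) auto
  ultimately show False using assms by linarith
qed

text \<open>Colour the pairs of \<open>n\<close> points so that every pair lies in more than \<open>n / 3\<close> monochromatic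
  triangles and every point sees at least two colours. There are no rainbow triangles and no
  points with three colours, since the third vertices of the monochromatic triangles would form
  three disjoint sets of more than \<open>n / 3\<close> points. So each point sees exactly two colours, each on
  more than \<open>n / 3\<close> pairs, and is therefore the centre of at least about \<open>2 n\<^sup>2 / 9\<close>
  bichromatic cherries. A triangle that is not monochromatic contains two such cherries, so there
  are at least about \<open>n\<^sup>3 / 9\<close> of these triangles. But each pair is in fewer than
  \<open>2 n / 3\<close> of them, so there are at most about \<open>n\<^sup>3 / 9\<close>. As both bounds agree to leading
  order, the contradiction comes from the lower-order terms.\<close>

lemma no_locally_bichromatic_clique:
  fixes col :: "'a \<Rightarrow> 'a \<Rightarrow> 'b"
  assumes fin: "finite N" and ne: "N \<noteq> {}"
    and sym: "\<And>u v. col u v = col v u"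
    and mono: "\<And>u v. u \<in> N \<Longrightarrow> v \<in> N \<Longrightarrow> u \<noteq> v \<Longrightarrow>
      card N < 3 * card {w \<in> N - {u, v}. col u w = col u v \<and> col v w = col u v}"
    and two: "\<And>v. v \<in> N \<Longrightarrow> \<exists>u\<in>N - {v}. \<exists>u'\<in>N - {v}. col v u \<noteq> col v u'"
  shows False
proof -
  define n where "n = real (card N)"
  define M where "M u v = {w \<in> N - {u, v}. col u w = col u v \<and> col v w = col u v}" for u v
  have M: "M u v \<subseteq> N" "card N < 3 * card (M u v)" if "u \<in> N" "v \<in> N" "u \<noteq> v" for u v
    using mono[OF that] by (auto simp: M_def)
  have MD: "col u w = col u v" "col v w = col u v" if "w \<in> M u v" for u v w
    using that by (auto simp: M_def)
  have no_rainbow: "col u v = col u w \<or> col u v = col v w \<or> col u w = col v w"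
    if "u \<in> N" "v \<in> N" "w \<in> N" "u \<noteq> v" "u \<noteq> w" "v \<noteq> w" for u v w
  proof -
    have "M u v \<inter> M u w \<noteq> {} \<or> M u v \<inter> M v w \<noteq> {} \<or> M u w \<inter> M v w \<noteq> {}"
      by (rule two_of_three_meet[OF fin]) (use M that in simp_all)
    then show ?thesis
      unfolding ex_in_conv[symmetric] Int_iff by (metis MD)
  qed
  have at_most_two: "col v a = col v b \<or> col v a = col v c \<or> col v b = col v c"
    if "v \<in> N" "a \<in> N - {v}" "b \<in> N - {v}" "c \<in> N - {v}" for v a b c
  proof -
    have "M v a \<inter> M v b \<noteq> {} \<or> M v a \<inter> M v c \<noteq> {} \<or> M v b \<inter> M v c \<noteq> {}"
      by (rule two_of_three_meet[OF fin]) (use M[of v] that in auto)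
    then show ?thesis
      unfolding ex_in_conv[symmetric] Int_iff by (metis MD(1))
  qed
  \<comment> \<open>\<open>f\<close> marks ordered bichromatic cherries with centre \<open>u\<close>, and \<open>g\<close> ordered triangles
    that are not monochromatic.\<close>
  define f where "f u v w = (of_bool (u \<noteq> v \<and> u \<noteq> w \<and> v \<noteq> w \<and> col u v \<noteq> col u w) :: real)" for u v w
  define g where "g u v w = (of_bool (u \<noteq> v \<and> u \<noteq> w \<and> v \<noteq> w \<and>
     \<not> (col u w = col u v \<and> col v w = col u v)) :: real)" for u v w
  define X where "X = (\<Sum>u\<in>N. \<Sum>v\<in>N. \<Sum>w\<in>N. f u v w)"
  define Y where "Y = (\<Sum>u\<in>N. \<Sum>v\<in>N. \<Sum>w\<in>N. g u v w)"
  have large: "n + 4 \<le> 3 * real (card {w \<in> N - {u}. col u w = col u v})"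
    if "u \<in> N" "v \<in> N" "u \<noteq> v" for u v
  proof -
    have "insert v (M u v) \<subseteq> {w \<in> N - {u}. col u w = col u v}" using that by (auto simp: M_def)
    then have "card (insert v (M u v)) \<le> card {w \<in> N - {u}. col u w = col u v}"
      using fin by (intro card_mono) auto
    moreover have "card (insert v (M u v)) = Suc (card (M u v))"
      using fin by (subst card_insert_disjoint) (auto simp: M_def)
    ultimately show ?thesis using M(2)[OF that] by (simp add: n_def)
  qed
  have lower_u: "2 * ((n + 4) * (2 * n - 7)) \<le> 9 * (\<Sum>v\<in>N. \<Sum>w\<in>N. f u v w) \<and> n > 4" if u: "u \<in> N" for u
  proof -
    obtain a b where ab: "a \<in> N - {u}" "b \<in> N - {u}" "col u a \<noteq> col u b" using two[OF u] by blast
    define A where "A = {w \<in> N - {u}. col u w = col u a}"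
    define B where "B = {w \<in> N - {u}. col u w = col u b}"
    have cover: "col u x = col u a \<or> col u x = col u b" if "x \<in> N - {u}" for x
      using at_most_two[OF u ab(1,2) that] ab(3) by metis
    then have AB: "A \<union> B = N - {u}" "A \<inter> B = {}"
      using ab(3) by (auto simp: A_def B_def)
    have fAB: "finite A" "finite B" using fin by (auto simp: A_def B_def)
    have sumAB: "real (card A) + real (card B) = n - 1"
    proof -
      have "card A + card B = card (N - {u})" using AB fAB card_Un_disjoint by metis
      also have "\<dots> = card N - 1" using u fin by simp
      finally show ?thesis using u fin card_gt_0_iff[of N] unfolding n_def by (auto simp: of_nat_diff)
    qed
    have gA: "n + 4 \<le> 3 * real (card A)" using large[OF u, of a] ab by (auto simp: A_def)
    have gB: "n + 4 \<le> 3 * real (card B)" using large[OF u, of b] ab by (auto simp: B_def)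
    have 1: "(\<Sum>w\<in>N. f u v w) = (if v \<in> A then real (card B) else if v \<in> B then real (card A) else 0)"
      if "v \<in> N" for v
    proof -
      have "(\<Sum>w\<in>N. f u v w) = real (card {w \<in> N. u \<noteq> v \<and> u \<noteq> w \<and> v \<noteq> w \<and> col u v \<noteq> col u w})"
        unfolding f_def using fin by (simp add: sum.If_cases of_bool_def Int_def)
      also have "{w \<in> N. u \<noteq> v \<and> u \<noteq> w \<and> v \<noteq> w \<and> col u v \<noteq> col u w} =
         (if v \<in> A then B else if v \<in> B then A else {})"
      proof (rule set_eqI)
        fix w
        have "v = u \<or> col u v = col u a \<or> col u v = col u b" "w \<in> N \<longrightarrow> w = u \<or> col u w = col u a \<or> col u w = col u b"
          using cover[of v] cover[of w] that by blast+
        then show "w \<in> {w \<in> N. u \<noteq> v \<and> u \<noteq> w \<and> v \<noteq> w \<and> col u v \<noteq> col u w} \<longleftrightarrow>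
          w \<in> (if v \<in> A then B else if v \<in> B then A else {})"
          using that ab(3) unfolding A_def B_def
          by (cases "v = u"; cases "w = u"; cases "col u v = col u a"; cases "col u w = col u a"; cases "v = w") auto
      qed
      finally show ?thesis by simp
    qed
    have "(\<Sum>v\<in>N. \<Sum>w\<in>N. f u v w) = (\<Sum>v\<in>N. if v \<in> A then real (card B) else if v \<in> B then real (card A) else 0)"
      by (intro sum.cong refl 1)
    also have "\<dots> = (\<Sum>v\<in>A \<union> B. if v \<in> A then real (card B) else if v \<in> B then real (card A) else 0)"
      using fin AB(1) by (intro sum.mono_neutral_right) auto
    also have "\<dots> = 2 * (real (card A) * real (card B))"
    proof -
      have "(\<Sum>v\<in>A. if v \<in> A then real (card B) else if v \<in> B then real (card A) else 0) = (\<Sum>v\<in>A. real (card B))"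
        by (intro sum.cong) auto
      moreover have "(\<Sum>v\<in>B. if v \<in> A then real (card B) else if v \<in> B then real (card A) else 0) = (\<Sum>v\<in>B. real (card A))"
        using AB(2) by (intro sum.cong) auto
      ultimately show ?thesis using fAB AB(2) by (simp add: sum.union_disjoint)
    qed
    finally have S: "(\<Sum>v\<in>N. \<Sum>w\<in>N. f u v w) = 2 * (real (card A) * real (card B))" .
    \<comment> \<open>for a fixed sum \<open>n - 1\<close> the product is least when one factor attains its lower bound\<close>
    have "0 \<le> (3 * real (card A) - (n + 4)) * (3 * real (card B) - (n + 4))"
      using gA gB by simp
    also have "\<dots> = 9 * (real (card A) * real (card B)) - 3 * (n + 4) * (real (card A) + real (card B)) + (n + 4) * (n + 4)"
      by (simp add: algebra_simps)
    also have "\<dots> = 9 * (real (card A) * real (card B)) - (n + 4) * (2 * n - 7)"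
      unfolding sumAB by (simp add: algebra_simps)
    finally show ?thesis using S sumAB gA gB by simp
  qed
  have n4: "n > 4" using lower_u ne by blast
  have X_lower: "n * (2 * ((n + 4) * (2 * n - 7))) \<le> 9 * X"
  proof -
    have "(\<Sum>u\<in>N. 2 * ((n + 4) * (2 * n - 7))) \<le> (\<Sum>u\<in>N. 9 * (\<Sum>v\<in>N. \<Sum>w\<in>N. f u v w))"
      using lower_u by (intro sum_mono) blast
    then show ?thesis by (simp add: X_def n_def sum_distrib_left)
  qed
  have Y_upper: "3 * Y \<le> n * (n - 1) * (2 * n - 7)"
  proof -
    have in_uv: "3 * (\<Sum>w\<in>N. g u v w) \<le> (if u = v then 0 else 2 * n - 7)" if uv: "u \<in> N" "v \<in> N" for u v
    proof (cases "u = v")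
      case True then show ?thesis by (simp add: g_def)
    next
      case False
      have "(\<Sum>w\<in>N. g u v w) = real (card {w \<in> N. u \<noteq> v \<and> u \<noteq> w \<and> v \<noteq> w \<and>
         \<not> (col u w = col u v \<and> col v w = col u v)})"
        unfolding g_def using fin by (simp add: sum.If_cases of_bool_def Int_def)
      also have "{w \<in> N. u \<noteq> v \<and> u \<noteq> w \<and> v \<noteq> w \<and>
         \<not> (col u w = col u v \<and> col v w = col u v)} = (N - {u, v}) - M u v"
        using False by (auto simp: M_def)
      also have "real (card ((N - {u, v}) - M u v)) = real (card (N - {u, v})) - real (card (M u v))"
      proof -
        have sub: "M u v \<subseteq> N - {u, v}" by (auto simp: M_def)
        then show ?thesis using fin finite_subset[OF sub] card_mono[OF _ sub]
          by (subst card_Diff_subset) (auto simp: of_nat_diff)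
      qed
      also have "real (card (N - {u, v})) = n - 2"
      proof -
        have "card {u, v} \<le> card N" using uv fin by (intro card_mono) auto
        then show ?thesis using uv fin False
          by (subst card_Diff_subset) (auto simp: of_nat_diff n_def)
      qed
      finally show ?thesis using M(2)[OF uv False] False by (simp add: n_def)
    qed
    have "3 * Y = (\<Sum>u\<in>N. \<Sum>v\<in>N. 3 * (\<Sum>w\<in>N. g u v w))"
      by (simp add: Y_def sum_distrib_left)
    also have "\<dots> \<le> (\<Sum>u\<in>N. \<Sum>v\<in>N. if u = v then 0 else 2 * n - 7)"
      using in_uv by (intro sum_mono) auto
    also have "\<dots> = (\<Sum>u\<in>N. (n - 1) * (2 * n - 7))"
    proof (rule sum.cong[OF refl])
      fix u assume u: "u \<in> N"
      have "(\<Sum>v\<in>N. if u = v then 0 else 2 * n - 7) = real (card (N - {u})) * (2 * n - 7)"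
        using fin by (subst sum.If_cases) (auto simp: Diff_eq Int_def intro!: arg_cong[where f = card])
      also have "real (card (N - {u})) = n - 1"
        using u fin card_gt_0_iff[of N] by (auto simp: n_def of_nat_diff)
      finally show "(\<Sum>v\<in>N. if u = v then 0 else 2 * n - 7) = (n - 1) * (2 * n - 7)" .
    qed
    also have "\<dots> = n * (n - 1) * (2 * n - 7)" by (simp add: n_def)
    finally show ?thesis .
  qed
  have "3 * X \<le> 2 * Y"
  proof -
    have X1: "X = (\<Sum>u\<in>N. \<Sum>v\<in>N. \<Sum>w\<in>N. f v u w)"
      unfolding X_def by (rule sum.swap)
    have X2: "X = (\<Sum>u\<in>N. \<Sum>v\<in>N. \<Sum>w\<in>N. f w u v)"
    proof -
      have "X = (\<Sum>u\<in>N. \<Sum>w\<in>N. \<Sum>v\<in>N. f w u v)" by (rule X1)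
      also have "\<dots> = (\<Sum>u\<in>N. \<Sum>v\<in>N. \<Sum>w\<in>N. f w u v)"
        by (rule sum.cong[OF refl]) (rule sum.swap)
      finally show ?thesis .
    qed
    have pt: "f u v w + f v u w + f w u v \<le> 2 * g u v w" if "u \<in> N" "v \<in> N" "w \<in> N" for u v w
    proof (cases "u \<noteq> v \<and> u \<noteq> w \<and> v \<noteq> w")
      case True
      then have "col u v = col u w \<or> col u v = col v w \<or> col u w = col v w"
        using no_rainbow that by blast
      then show ?thesis
        using True sym[of v u] sym[of w u] sym[of w v] by (auto simp: f_def g_def)
    qed (auto simp: f_def g_def)
    have "3 * X = (\<Sum>u\<in>N. \<Sum>v\<in>N. \<Sum>w\<in>N. f u v w) + (\<Sum>u\<in>N. \<Sum>v\<in>N. \<Sum>w\<in>N. f v u w)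
      + (\<Sum>u\<in>N. \<Sum>v\<in>N. \<Sum>w\<in>N. f w u v)"
      unfolding X_def[symmetric] X1[symmetric] X2[symmetric] by simp
    also have "\<dots> = (\<Sum>u\<in>N. \<Sum>v\<in>N. \<Sum>w\<in>N. f u v w + f v u w + f w u v)"
      by (simp add: sum.distrib)
    also have "\<dots> \<le> (\<Sum>u\<in>N. \<Sum>v\<in>N. \<Sum>w\<in>N. 2 * g u v w)"
      by (intro sum_mono pt)
    also have "\<dots> = 2 * Y" by (simp add: Y_def sum_distrib_left)
    finally show ?thesis .
  qed
  then have "n * (2 * ((n + 4) * (2 * n - 7))) \<le> 2 * (n * (n - 1) * (2 * n - 7))"
    using X_lower Y_upper by linarith
  then have "(n * (2 * n - 7)) * (n + 4) \<le> (n * (2 * n - 7)) * (n - 1)"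
    by (simp add: algebra_simps)
  moreover have "0 < n * (2 * n - 7)" using n4 by simp
  ultimately have "n + 4 \<le> n - 1" by (rule mult_left_le_imp_le)
  then show False by simp
qed

section \<open>Edges of a dense family split into two classes\<close>

locale dense_family = equicardinal_family +
  fixes V :: "'a set"
  assumes fin_V: "finite V" and edge_sub: "e \<in> E \<Longrightarrow> e \<subseteq> V" and k_ge_3: "3 \<le> k"
    and dense: "S \<subseteq> V \<Longrightarrow> card S = k - 1 \<Longrightarrow> card V < 3 * card {w \<in> V. insert w S \<in> E}"
begin

definition nbrs :: "'a set \<Rightarrow> 'a set" where
  "nbrs S = {w \<in> V. insert w S \<in> E}"

text \<open>Adjacent vertices of \<open>e\<close> can be swapped. Among any three vertices of \<open>e\<close> two are adjacent,
  since three sets of size \<open>k - 1\<close> cannot have pairwise disjoint neighbourhoods.\<close>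

definition adj :: "'a set \<Rightarrow> 'a \<Rightarrow> 'a \<Rightarrow> bool" where
  "adj e u v \<longleftrightarrow> nbrs (e - {u}) \<inter> nbrs (e - {v}) \<noteq> {}"

lemma nbrsD:
  assumes "w \<in> nbrs S" "card S = k - 1" "S \<subseteq> V"
  shows "insert w S \<in> E" "w \<in> V" "w \<notin> S"
proof -
  show "insert w S \<in> E" "w \<in> V" using assms by (auto simp: nbrs_def)
  then show "w \<notin> S" using card_edge[of "insert w S"] assms(2) k_ge_3 by (auto simp: insert_absorb)
qed

lemma ex_nbr: "S \<subseteq> V \<Longrightarrow> card S = k - 1 \<Longrightarrow> \<exists>w. w \<in> nbrs S"
  using dense[of S] unfolding nbrs_def[symmetric] by (metis card.empty equals0I mult_0_right not_less0)

lemma nbrs_meet: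
  assumes "S1 \<subseteq> V" "card S1 = k - 1" "S2 \<subseteq> V" "card S2 = k - 1" "S3 \<subseteq> V" "card S3 = k - 1"
  shows "nbrs S1 \<inter> nbrs S2 \<noteq> {} \<or> nbrs S1 \<inter> nbrs S3 \<noteq> {} \<or> nbrs S2 \<inter> nbrs S3 \<noteq> {}"
  using two_of_three_meet[OF fin_V, of "nbrs S1" "nbrs S2" "nbrs S3"] assms dense
  by (auto simp: nbrs_def)

lemma card_edge_minus: "e \<in> E \<Longrightarrow> u \<in> e \<Longrightarrow> card (e - {u}) = k - 1"
  using card_edge finite_edge by simp

lemma adj_refl: "e \<in> E \<Longrightarrow> u \<in> e \<Longrightarrow> adj e u u"
  using edge_sub by (auto simp: adj_def nbrs_def insert_absorb intro!: exI[of _ u])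

lemma adj_sym: "adj e u v \<Longrightarrow> adj e v u"
  by (auto simp: adj_def)

lemma adj_three:
  assumes "e \<in> E" "u \<in> e" "v \<in> e" "w \<in> e"
  shows "adj e u v \<or> adj e u w \<or> adj e v w"
  unfolding adj_def by (rule nbrs_meet) (use assms edge_sub card_edge_minus in auto)

lemma adj_swappable:
  assumes "e \<in> E" "u \<in> e" "v \<in> e" "adj e u v"
  shows "swappable 3 e u v"
proof (cases "u = v")
  case True then show ?thesis using swappable_refl assms by simp
next
  case False
  obtain w where "insert w (e - {u}) \<in> E" "insert w (e - {v}) \<in> E"
    using assms(4) by (auto simp: adj_def nbrs_def)
  then show ?thesis using swappable_common_neighbour assms False by blast
qed

end

text \<open>Without a closed walk the family will turn out to be empty. No edge can have all its pairs swappable within \<open>20\<close> blocks, as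
  \<open>l \<ge> 20 k\<^sup>2\<close> leaves room for \<open>20 k\<close> blocks and a rotation takes at most \<open>k\<close> swaps.\<close>

locale dense_family_without_walk = dense_family +
  fixes l :: nat
  assumes no_walk: "\<not> (\<exists>f. closed_tight_walk l f \<and> f ` {..<l} \<subseteq> V)"
    and k_less_l: "k < l" and l_large: "20 * k ^ 2 \<le> l"
    and odd_cycles: "odd (k div gcd k l)"
begin

lemma no_walk_Union: "\<not> (\<exists>f. closed_tight_walk l f \<and> f ` {..<l} \<subseteq> \<Union>E)"
  using no_walk edge_sub by (meson Sup_least subset_trans)

lemma cost_bound: "c \<le> 20 \<Longrightarrow> c * k \<le> l div k"
proof -
  assume "c \<le> 20"
  then have "c * k * k \<le> 20 * k ^ 2" by (simp add: power2_eq_square)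
  also have "\<dots> \<le> l" by (rule l_large)
  finally show ?thesis using k_pos by (simp add: less_eq_div_iff_mult_less_eq)
qed

lemma not_all_swappable:
  assumes "e \<in> E" "c \<le> 20"
  shows "\<exists>u\<in>e. \<exists>t\<in>e. \<not> swappable c e u t"
  using closed_tight_walk_if_all_swappable[OF assms(1) _ cost_bound[OF assms(2)] k_less_l] no_walk_Union
  by blast

text \<open>If \<open>u\<close>, \<open>v\<close>, \<open>w\<close> is a path but \<open>u\<close> and \<open>w\<close> are not adjacent, then every vertex is adjacent
  to \<open>u\<close> or to \<open>w\<close>, and any two vertices are joined by a path of at most three edges. This
  makes all pairs swappable at cost \<open>2 \<cdot> 3 + (2 \<cdot> 3 + 3) = 15\<close>.\<close>

lemma adj_trans:
  assumes e: "e \<in> E" "u \<in> e" "v \<in> e" "w \<in> e" and uvw: "adj e u v" "adj e v w"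
  shows "adj e u w"
proof (rule ccontr)
  assume n: "\<not> adj e u w"
  have "swappable 15 e z z'" if z: "z \<in> e" "z' \<in> e" for z z'
  proof -
    have "\<exists>a\<in>e. \<exists>b\<in>e. adj e z a \<and> adj e a b \<and> adj e b z'"
    proof -
      have "adj e z u \<or> adj e z w" "adj e z' u \<or> adj e z' w"
        using adj_three[OF e(1) _ e(2,4)] z n by blast+
      moreover have "adj e z z' \<or> adj e z v \<or> adj e z' v" using adj_three[OF e(1) z e(3)] .
      ultimately show ?thesis
        using adj_refl[OF e(1)] adj_sym uvw e(2-4) z by metis
    qed
    then obtain a b where ab: "a \<in> e" "b \<in> e" "adj e z a" "adj e a b" "adj e b z'" by blast
    have "swappable (2 * 3 + 3) e a z'"
      using swappable_trans[OF e(1) ab(2)] adj_swappable[OF e(1)] ab z by blast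
    then have "swappable (2 * 3 + (2 * 3 + 3)) e z z'"
      using swappable_trans[OF e(1) ab(1)] adj_swappable[OF e(1)] ab z by blast
    then show ?thesis by simp
  qed
  then show False using not_all_swappable[OF e(1), of 15] by auto
qed

lemma ex_not_adj:
  assumes "e \<in> E" "u \<in> e" shows "\<exists>v\<in>e. \<not> adj e u v"
proof (rule ccontr)
  assume "\<not> ?thesis"
  then have "adj e z z'" if "z \<in> e" "z' \<in> e" for z z'
    using that assms adj_trans adj_sym by blast
  then show False using not_all_swappable[OF assms(1), of 3] adj_swappable[OF assms(1)] by auto
qed

text \<open>Transport along the step from \<open>e\<close> to \<open>e - v + w\<close>. If adjacency in the two edges did not
  agree, then both relations together would join any two vertices of \<open>e\<close> by a path of at most two
  edges, each worth a swap of cost \<open>3 + 2\<close>, and all pairs would be swappable at cost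
  \<open>15\<close>.\<close>

lemma adj_move:
  assumes e: "e \<in> E" "v \<in> e" and w: "w \<notin> e" and e': "insert w (e - {v}) \<in> E"
    and u: "u \<in> e" "u \<noteq> v" and uv: "adj e u v"
  shows "adj (insert w (e - {v})) u w"
proof (rule ccontr)
  let ?e' = "insert w (e - {v})"
  define h where "h x = (if x = v then w else x)" for x
  assume n: "\<not> adj ?e' u w"
  then have n': "\<not> adj ?e' (h u) (h v)" using u by (simp add: h_def)
  have h: "h x \<in> ?e'" if "x \<in> e" for x using that by (simp add: h_def)
  have sw: "swappable 5 e z z'" if "z \<in> e" "z' \<in> e" "adj e z z' \<or> adj ?e' (h z) (h z')" for z z'
  proof (cases "adj e z z' \<or> z = z'")
    case True
    then have "swappable 3 e z z'" using that adj_swappable e(1) swappable_refl by blast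
    then show ?thesis using swappable_mono e(1) by fastforce
  next
    case False
    then have "swappable 3 ?e' (h z) (h z')" using adj_swappable[OF e'] h that by blast
    then have "swappable (3 + 2) e z z'"
      using False that by (intro swappable_pullback[OF e e' w]) (auto simp: h_def)
    then show ?thesis by simp
  qed
  have "swappable 15 e z z'" if z: "z \<in> e" "z' \<in> e" for z z'
  proof -
    have three': "adj ?e' (h x) (h u) \<or> adj ?e' (h x) (h v)" if "x \<in> e" for x
      using adj_three[OF e', of "h x" "h u" "h v"] h that u e(2) n' by blast
    have "\<exists>b\<in>e. (adj e z b \<or> adj ?e' (h z) (h b)) \<and> (adj e b z' \<or> adj ?e' (h b) (h z'))"
    proof -
      consider "adj e z z'" | "adj e z u" | "adj e z' u"
        using adj_three[OF e(1), of z z' u] z u by blast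
      then show ?thesis
      proof cases
        case 1 then show ?thesis using adj_refl[OF e(1)] z by blast
      next
        case 2
        then have "adj e z v" using adj_trans[OF e(1)] z u e(2) uv by blast
        then show ?thesis using three'[OF z(2)] adj_sym 2 u e(2) by blast
      next
        case 3
        then have "adj e z' v" using adj_trans[OF e(1)] z u e(2) uv by blast
        then show ?thesis using three'[OF z(1)] adj_sym 3 u e(2) by blast
      qed
    qed
    then obtain b where "b \<in> e" "swappable 5 e z b" "swappable 5 e b z'" using sw z by blast
    then have "swappable (2 * 5 + 5) e z z'" using swappable_trans[OF e(1)] by blast
    then show ?thesis by simp
  qed
  then show False using not_all_swappable[OF e(1), of 15] by auto
qed

text \<open>Adjacency in an edge is an equivalence relation with exactly two classes. By \<open>adj_move\<close>, the part
  \<open>act S\<close> of a set \<open>S\<close> of size \<open>k - 1\<close> whose class a new vertex \<open>w\<close> joins is the same for all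
  edges \<open>S + w\<close>.\<close>

definition cls :: "'a set \<Rightarrow> 'a \<Rightarrow> 'a set" where
  "cls e u = {t \<in> e. adj e u t}"

definition act :: "'a set \<Rightarrow> 'a set" where
  "act S = {u \<in> S. \<exists>w\<in>nbrs S. adj (insert w S) u w}"

lemma act_subset: "act S \<subseteq> S"
  by (auto simp: act_def)

lemma act_iff:
  assumes e: "e \<in> E" "v \<in> e" and u: "u \<in> e" "u \<noteq> v"
  shows "u \<in> act (e - {v}) \<longleftrightarrow> adj e u v"
proof
  assume "adj e u v"
  then show "u \<in> act (e - {v})"
    using e u edge_sub by (auto simp: act_def nbrs_def insert_absorb intro!: exI[of _ v])
next
  assume "u \<in> act (e - {v})"
  then obtain w where w: "insert w (e - {v}) \<in> E" "adj (insert w (e - {v})) u w"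
    by (auto simp: act_def nbrs_def)
  show "adj e u v"
  proof (cases "w = v")
    case True then show ?thesis using w e by (simp add: insert_absorb)
  next
    case False
    have "w \<notin> e"
    proof
      assume "w \<in> e"
      then have "insert w (e - {v}) = e - {v}" using False by blast
      then show False using card_edge[OF w(1)] card_edge_minus[OF e] k_ge_3 by simp
    qed
    moreover have "insert v (insert w (e - {v}) - {w}) = e" using \<open>w \<notin> e\<close> e by auto
    ultimately show ?thesis using adj_move[OF w(1), of w v u] w(2) u e False by auto
  qed
qed

lemma cls_eq_insert_act: "e \<in> E \<Longrightarrow> v \<in> e \<Longrightarrow> cls e v = insert v (act (e - {v}))"
  using act_iff[of e v] adj_refl[of e v] adj_sym act_subset[of "e - {v}"]
  unfolding cls_def by blast

lemma cls_same: "e \<in> E \<Longrightarrow> u \<in> e \<Longrightarrow> v \<in> e \<Longrightarrow> adj e u v \<Longrightarrow> cls e u = cls e v"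
  unfolding cls_def using adj_trans adj_sym by blast

lemma cls_other:
  assumes "e \<in> E" "u \<in> e" "v \<in> e" "\<not> adj e u v" shows "cls e u = e - cls e v"
  unfolding cls_def using adj_three[OF assms(1-3)] adj_trans[OF assms(1)] adj_sym assms by blast

section \<open>Links of sets of size k - 2\<close>

text \<open>Fix a set \<open>R\<close> of size \<open>k - 2\<close>. A vertex \<open>x\<close> splits \<open>R\<close> into the active part \<open>trace R x\<close>
  and the rest. It is pure if it lies in the active part itself, so that a third vertex joins its
  class, and mixed if a third vertex joins the other class. By \<open>mixed_link\<close> below, all vertices outside \<open>R\<close>
  are of the same kind, and the link of \<open>R\<close> is called pure or mixed accordingly.\<close>

definition pure :: "'a set \<Rightarrow> 'a \<Rightarrow> bool" where
  "pure R x \<longleftrightarrow> x \<in> act (insert x R)"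

definition trace :: "'a set \<Rightarrow> 'a \<Rightarrow> 'a set" where
  "trace R x = act (insert x R) - {x}"

lemma trace_subset: "trace R x \<subseteq> R"
  using act_subset[of "insert x R"] by (auto simp: trace_def)

lemma card_link: 
  assumes "R \<subseteq> V" "card R = k - 2" "x \<in> V - R"
  shows "insert x R \<subseteq> V" "card (insert x R) = k - 1"
  using assms finite_subset[OF assms(1) fin_V] k_ge_3 by auto

text \<open>Both facts about \<open>w\<close> are read off from the edge \<open>R + x + w\<close>: its classes are determined by
  \<open>act (insert x R)\<close> as well as by \<open>act (insert w R)\<close>. If \<open>x\<close> is pure, then \<open>x\<close> and \<open>w\<close> share a
  class; otherwise they lie in different classes.\<close>

lemma link_step:
  assumes R: "R \<subseteq> V" "card R = k - 2" "x \<in> V - R" and w: "w \<in> nbrs (insert x R)"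
  shows "w \<in> V - R" "w \<noteq> x" "x \<in> nbrs (insert w R)" "pure R w \<longleftrightarrow> pure R x"
    "trace R w = (if pure R x then trace R x else R - trace R x)"
proof -
  let ?e = "insert w (insert x R)"
  note n = nbrsD[OF w card_link(2)[OF R] card_link(1)[OF R]]
  show wV: "w \<in> V - R" "w \<noteq> x" using n by auto
  show "x \<in> nbrs (insert w R)" using n(1) R by (simp add: nbrs_def insert_commute)
  have x: "x \<notin> R" using R by simp
  have e: "?e - {w} = insert x R" "?e - {x} = insert w R" using n x by auto
  have cw: "cls ?e w = insert w (act (insert x R))"
    using cls_eq_insert_act[OF n(1), of w] e by simp
  have cx: "cls ?e x = insert x (act (insert w R))"
    using cls_eq_insert_act[OF n(1), of x] e by simp
  have px: "pure R x \<longleftrightarrow> adj ?e x w" using act_iff[OF n(1), of w x] e wV by (simp add: pure_def)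
  have pw: "pure R w \<longleftrightarrow> adj ?e w x" using act_iff[OF n(1), of x w] e wV by (simp add: pure_def)
  show "pure R w \<longleftrightarrow> pure R x" using px pw adj_sym by blast
  have sub: "act (insert x R) \<subseteq> insert x R" "act (insert w R) \<subseteq> insert w R" using act_subset by auto
  show "trace R w = (if pure R x then trace R x else R - trace R x)"
  proof (cases "pure R x")
    case True
    then have "cls ?e x = cls ?e w" using cls_same[OF n(1)] px by blast
    then show ?thesis using True cw cx sub wV x unfolding trace_def by (auto; blast)
  next
    case False
    then have "cls ?e x = ?e - cls ?e w" using cls_other[OF n(1)] px by blast
    then show ?thesis using False cw cx sub wV x unfolding trace_def by (auto; blast)
  qed
qed

lemma link_common:
  assumes R: "R \<subseteq> V" "card R = k - 2" and x: "x \<in> V - R" and y: "y \<in> V - R"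
    and meet: "nbrs (insert x R) \<inter> nbrs (insert y R) \<noteq> {}"
  shows "pure R x \<longleftrightarrow> pure R y" "trace R x = trace R y"
proof -
  obtain w where w: "w \<in> nbrs (insert x R)" "w \<in> nbrs (insert y R)" using meet by blast
  note s = link_step[OF R x w(1)] link_step[OF R y w(2)]
  show "pure R x \<longleftrightarrow> pure R y" using s by blast
  then show "trace R x = trace R y"
    using s(5,10) trace_subset[of R x] trace_subset[of R y] by (auto split: if_splits)
qed

lemma link_three:
  assumes R: "R \<subseteq> V" "card R = k - 2" and x: "x \<in> V - R" "y \<in> V - R" "z \<in> V - R"
  shows "(pure R x = pure R y \<and> trace R x = trace R y) \<or> (pure R x = pure R z \<and> trace R x = trace R z) \<or>
     (pure R y = pure R z \<and> trace R y = trace R z)"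
proof -
  have "nbrs (insert x R) \<inter> nbrs (insert y R) \<noteq> {} \<or> nbrs (insert x R) \<inter> nbrs (insert z R) \<noteq> {} \<or>
    nbrs (insert y R) \<inter> nbrs (insert z R) \<noteq> {}"
    using card_link[OF R] x by (intro nbrs_meet) auto
  then show ?thesis using link_common[OF R] x by blast
qed

text \<open>A mixed \<open>x\<close> and a neighbour \<open>w\<close> of \<open>R + x\<close> have complementary traces, which differ as \<open>R\<close>
  is not empty. So \<open>R + x\<close> and \<open>R + w\<close> have disjoint neighbourhoods, and for every \<open>y\<close> the
  neighbourhood of \<open>R + y\<close> meets one of the two.\<close>

lemma mixed_link:
  assumes R: "R \<subseteq> V" "card R = k - 2" and x: "x \<in> V - R" "\<not> pure R x" and y: "y \<in> V - R"
  shows "\<not> pure R y" "trace R y = trace R x \<or> trace R y = R - trace R x"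
proof -
  obtain w where w: "w \<in> nbrs (insert x R)" using ex_nbr card_link[OF R x(1)] by blast
  note s = link_step[OF R x(1) w]
  have "R \<noteq> {}" using R k_ge_3 by auto
  then have ne: "trace R x \<noteq> trace R w" using s(5) x(2) trace_subset[of R x] by auto
  have "(pure R y = pure R x \<and> trace R y = trace R x) \<or> (pure R y = pure R w \<and> trace R y = trace R w)"
    using link_three[OF R x(1) s(1) y] ne by auto
  then show "\<not> pure R y" "trace R y = trace R x \<or> trace R y = R - trace R x"
    using s x(2) by auto
qed

lemma passive_nonempty:
  assumes R: "R \<subseteq> V" "card R = k - 2" and x: "x \<in> V - R" "pure R x"
  shows "R - trace R x \<noteq> {}"
proof -
  obtain w where w: "w \<in> nbrs (insert x R)" using ex_nbr card_link[OF R x(1)] by blast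
  note n = nbrsD[OF w card_link(2)[OF R x(1)] card_link(1)[OF R x(1)]]
  obtain t where t: "t \<in> insert w (insert x R)" "\<not> adj (insert w (insert x R)) w t"
    using ex_not_adj[OF n(1)] by blast
  have "t \<noteq> w" using adj_refl[OF n(1)] t by auto
  moreover have "insert w (insert x R) - {w} = insert x R" using n by auto
  ultimately have "t \<notin> act (insert x R)" using act_iff[OF n(1), of w t] t adj_sym by auto
  then show ?thesis using t \<open>t \<noteq> w\<close> x unfolding pure_def trace_def by blast
qed

lemma at_most_two_traces:
  assumes R: "R \<subseteq> V" "card R = k - 2" and x: "x \<in> V - R" "y \<in> V - R" "z \<in> V - R"
  shows "trace R x = trace R y \<or> trace R x = trace R z \<or> trace R y = trace R z"
  using link_three[OF R x] by blast

text \<open>Consider \<open>T = R - y\<close>. As \<open>y\<close> is passive for \<open>R + x\<close>, it is mixed for \<open>T + x\<close>, and so the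
  link of \<open>T + x\<close> is mixed; the same holds for \<open>T + w\<close> with \<open>w\<close> a neighbour of \<open>R + x\<close>. This determines
  \<open>act (T + x + w)\<close> as \<open>T - trace R x\<close>. A neighbour \<open>z \<noteq> y\<close> of \<open>T + x + w\<close> then has
  \<open>x\<close> on the active side of \<open>T + z + x\<close>, so the link of \<open>T + z\<close> is pure, and \<open>y\<close> in it is pure, which
  puts \<open>y\<close> on the active side of \<open>R + z\<close>.\<close>

lemma pure_other_trace:
  assumes R: "R \<subseteq> V" "card R = k - 2" and x: "x \<in> V - R" "pure R x" and y: "y \<in> R - trace R x"
  shows "\<exists>z\<in>V - R. pure R z \<and> y \<in> trace R z"
proof -
  let ?T = "R - {y}" and ?P = "trace R x"
  have finR: "finite R" using R fin_V finite_subset by blast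
  have "card ?T = card R - 1" using y by simp
  moreover have "0 < card R" using R k_ge_3 by simp
  ultimately have cT: "Suc (card ?T) = k - 2" using R by simp
  have yR: "insert y ?T = R" using y by auto
  have RT: "insert v ?T \<subseteq> V" "card (insert v ?T) = k - 2" "y \<in> V - insert v ?T" if "v \<in> V - R" for v
    using that R y finR cT by auto
  have ins: "insert y (insert v ?T) = insert v R" for v using yR by blast
  obtain w where w: "w \<in> nbrs (insert x R)" using ex_nbr card_link[OF R x(1)] by blast
  note s = link_step[OF R x(1) w]
  have mixed: "\<not> pure (insert v ?T) y" "trace (insert v ?T) y = insert v ?P"
    if v: "v \<in> V - R" "pure R v" "trace R v = ?P" for v
  proof -
    have "act (insert v R) = insert v ?P" using v unfolding pure_def trace_def by blast
    moreover have "y \<noteq> v" using v y by auto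
    ultimately show "\<not> pure (insert v ?T) y" "trace (insert v ?T) y = insert v ?P"
      using y unfolding pure_def trace_def[of "insert v ?T"] ins by auto
  qed
  note mx = mixed[OF x refl]
  have mw: "\<not> pure (insert w ?T) y" using mixed[OF s(1)] s x by auto
  have wx: "w \<in> V - insert x ?T" "x \<in> V - insert w ?T" using s x y by auto
  have 1: "\<not> pure (insert x ?T) w" using mixed_link[OF RT(1,2)[OF x(1)] RT(3)[OF x(1)] mx(1) wx(1)] by simp
  have 2: "\<not> pure (insert w ?T) x" using mixed_link[OF RT(1,2)[OF s(1)] RT(3)[OF s(1)] mw wx(2)] by simp
  \<comment> \<open>in the link of \<open>T + w\<close> the vertex \<open>x\<close> is mixed, which excludes one of the two traces of
    \<open>mixed_link\<close>\<close>
  have "x \<notin> trace (insert x ?T) w"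
    using 2 unfolding pure_def trace_def by (simp add: insert_commute)
  then have tr: "trace (insert x ?T) w = insert x ?T - insert x ?P"
    using mixed_link(2)[OF RT(1,2)[OF x(1)] RT(3)[OF x(1)] mx(1) wx(1)] mx(2) by auto
  let ?S = "insert w (insert x ?T)"
  have S: "?S \<subseteq> V" "card ?S = k - 1" using card_link[OF RT(1,2)[OF x(1)] wx(1)] .
  have "3 \<le> card V"
  proof -
    have "insert w (insert x R) \<in> E" using w by (simp add: nbrs_def)
    then have "k \<le> card V" using card_edge edge_sub card_mono[OF fin_V] by metis
    then show ?thesis using k_ge_3 by simp
  qed
  then have "2 \<le> card (nbrs ?S)" using dense[OF S] unfolding nbrs_def[symmetric] by simp
  then have "\<not> nbrs ?S \<subseteq> {y}" using card_mono[of "{y}" "nbrs ?S"] by auto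
  then obtain z where z: "z \<in> nbrs ?S" "z \<noteq> y" by blast
  note sz = link_step[OF RT(1,2)[OF x(1)] wx(1) z(1)]
  have zR: "z \<in> V - R" using sz(1) z(2) by auto
  have zx: "z \<noteq> x" using sz(1) by auto
  have "trace (insert x ?T) z = insert x ?T - (insert x ?T - insert x ?P)" using sz(5) 1 tr by simp
  then have "x \<in> trace (insert x ?T) z" by auto
  then have "pure (insert z ?T) x" unfolding pure_def trace_def by (auto simp: insert_commute)
  moreover have "x \<in> V - insert z ?T" using x zx by auto
  ultimately have "pure (insert z ?T) y"
    using mixed_link(1)[OF RT(1,2)[OF zR] RT(3)[OF zR]] by blast
  then have "y \<in> act (insert z R)" unfolding pure_def ins .
  moreover have "pure R z" using mixed_link(1)[OF R zR _ x(1)] x(2) by blast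
  ultimately show ?thesis using zR z(2) unfolding trace_def by blast
qed

lemma passive_subset_other_trace:
  assumes R: "R \<subseteq> V" "card R = k - 2" and x: "x \<in> V - R" "pure R x" and z: "z \<in> V - R"
    and ne: "trace R x \<noteq> trace R z"
  shows "R - trace R x \<subseteq> trace R z"
  using pure_other_trace[OF R x] at_most_two_traces[OF R x(1) z] ne by blast

text \<open>Suppose that \<open>p\<close> is in both traces and put \<open>T = R - p\<close>. Then the link of \<open>T + v\<close> is pure
  for every vertex \<open>v\<close>, for \<open>v = p\<close> because of \<open>x\<close> and otherwise because of \<open>p\<close>. Colour the pair
  \<open>u v\<close> by the active part of \<open>T + u + v\<close> inside \<open>T\<close>. Neighbours of \<open>T + u + v\<close> form
  monochromatic triangles with \<open>u\<close> and \<open>v\<close>, and every vertex sees two colours by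
  \<open>pure_other_trace\<close>, which contradicts \<open>no_locally_bichromatic_clique\<close>.\<close>

lemma traces_disjoint:
  assumes R: "R \<subseteq> V" "card R = k - 2" and x: "x \<in> V - R" "pure R x" and z: "z \<in> V - R"
    and ne: "trace R x \<noteq> trace R z"
  shows "trace R x \<inter> trace R z = {}"
proof (rule ccontr)
  assume "trace R x \<inter> trace R z \<noteq> {}"
  then obtain p where p: "p \<in> trace R x" "p \<in> trace R z" by blast
  have pR: "p \<in> R" using p trace_subset by blast
  let ?T = "R - {p}"
  let ?N = "V - ?T"
  have finR: "finite R" using R fin_V finite_subset by blast
  have "0 < card R" using R k_ge_3 by simp
  then have cT: "Suc (card ?T) = k - 2" using R pR by simp
  have T: "insert v ?T \<subseteq> V" "card (insert v ?T) = k - 2" if "v \<in> ?N" for v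
    using that R finR cT by auto
  have all_pure: "pure (insert v ?T) u" if v: "v \<in> ?N" and u: "u \<in> ?N" "u \<noteq> v" for u v
  proof -
    have ex: "\<exists>y\<in>V - insert v ?T. pure (insert v ?T) y"
    proof (cases "v = p")
      case True
      then show ?thesis using x pR by (auto simp: insert_absorb)
    next
      case False
      then have vR: "v \<in> V - R" using v by auto
      then have "p \<in> trace R v" using at_most_two_traces[OF R x(1) z] ne p by metis
      moreover have "insert p (insert v ?T) = insert v R" using pR by blast
      ultimately have "pure (insert v ?T) p" unfolding pure_def trace_def by simp
      then show ?thesis using False pR R by auto
    qed
    then show ?thesis using mixed_link(1)[OF T[OF v]] u by blast
  qed
  define col where "col u v = act (insert u (insert v ?T)) - {u, v}" for u v
  have sym: "col u v = col v u" for u v by (simp add: col_def insert_commute)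
  have tr: "trace (insert v ?T) u = insert v (col u v)" if "u \<in> ?N" "v \<in> ?N" "u \<noteq> v" for u v
    using all_pure[OF that(1,2)] that unfolding pure_def trace_def col_def by (auto simp: insert_commute)
  have tr_eq: "trace (insert v ?T) u = trace (insert v ?T) w \<longleftrightarrow> col v u = col v w"
    if "u \<in> ?N" "w \<in> ?N" "v \<in> ?N" "u \<noteq> v" "w \<noteq> v" for u v w
  proof -
    have "v \<notin> col u v" "v \<notin> col w v" by (auto simp: col_def)
    then show ?thesis using tr[of u v] tr[of w v] that sym by (metis insert_ident)
  qed
  show False
  proof (rule no_locally_bichromatic_clique[of ?N col])
    show "finite ?N" using fin_V by simp
    show "?N \<noteq> {}" using pR R by blast
    show "col u v = col v u" for u v by (rule sym)
  next
    fix u v assume uv: "u \<in> ?N" "v \<in> ?N" "u \<noteq> v"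
    have "u \<in> V - insert v ?T" "v \<in> V - insert u ?T" using uv by auto
    note lu = link_step[OF T[OF uv(2)] this(1)] and lv = link_step[OF T[OF uv(1)] this(2)]
    have cl: "insert u (insert v ?T) \<subseteq> V" "card (insert u (insert v ?T)) = k - 1"
      using card_link[OF T[OF uv(2)]] \<open>u \<in> V - insert v ?T\<close> by auto
    have sub: "nbrs (insert u (insert v ?T)) \<subseteq> {w \<in> ?N - {u, v}. col u w = col u v \<and> col v w = col u v}"
    proof
      fix w assume w: "w \<in> nbrs (insert u (insert v ?T))"
      then have w': "w \<in> nbrs (insert v (insert u ?T))" by (simp add: insert_commute)
      have wN: "w \<in> ?N - {u, v}" using lu(1,2)[OF w] by auto
      have "trace (insert v ?T) w = trace (insert v ?T) u" using lu(5)[OF w] all_pure[OF uv(2,1,3)] by simp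
      then have 1: "col v w = col v u" using tr_eq[of w u v] wN uv by auto
      have "trace (insert u ?T) w = trace (insert u ?T) v" using lv(5)[OF w'] all_pure[OF uv(1,2)] uv by simp
      then have 2: "col u w = col u v" using tr_eq[of w v u] wN uv by auto
      show "w \<in> {w \<in> ?N - {u, v}. col u w = col u v \<and> col v w = col u v}"
        using wN 1 2 sym by auto
    qed
    have "card ?N \<le> card V" using fin_V by (intro card_mono) auto
    also have "\<dots> < 3 * card (nbrs (insert u (insert v ?T)))" using dense[OF cl] by (simp add: nbrs_def)
    also have "\<dots> \<le> 3 * card {w \<in> ?N - {u, v}. col u w = col u v \<and> col v w = col u v}"
      using card_mono[OF _ sub] fin_V by simp
    finally show "card ?N < 3 * card {w \<in> ?N - {u, v}. col u w = col u v \<and> col v w = col u v}" .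
  next
    fix v assume v: "v \<in> ?N"
    have "card (insert v ?T) < card V"
    proof -
      have "card (insert v ?T) < card (insert x R)" using T(2)[OF v] card_link(2)[OF R x(1)] k_ge_3 by simp
      also have "\<dots> \<le> card V" using card_link(1)[OF R x(1)] fin_V by (intro card_mono) auto
      finally show ?thesis .
    qed
    moreover have "finite (insert v ?T)" using T(1)[OF v] fin_V by (rule finite_subset)
    ultimately have "\<not> V \<subseteq> insert v ?T" using card_mono by (meson not_less)
    then obtain u where u: "u \<in> V - insert v ?T" by blast
    have pu: "pure (insert v ?T) u" using all_pure[OF v] u by blast
    obtain y where y: "y \<in> insert v ?T - trace (insert v ?T) u"
      using passive_nonempty[OF T[OF v] u pu] by blast
    obtain u' where u': "u' \<in> V - insert v ?T" "y \<in> trace (insert v ?T) u'"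
      using pure_other_trace[OF T[OF v] u pu y] by blast
    have "trace (insert v ?T) u \<noteq> trace (insert v ?T) u'" using y u' by blast
    then have "col v u \<noteq> col v u'" by (subst tr_eq[symmetric]) (use u u' v in blast)+
    then show "\<exists>u\<in>?N - {v}. \<exists>u'\<in>?N - {v}. col v u \<noteq> col v u'" using u u'(1) by blast
  qed
qed

section \<open>Class sizes\<close>

text \<open>Remove two vertices \<open>u\<close>, \<open>v\<close> of the same class and let \<open>R\<close> be the rest of the edge. Its
  link is pure, with the rest \<open>P\<close> of the class as one trace. The other trace of that link contains
  \<open>R - P\<close> and is disjoint from \<open>P\<close>, so it equals \<open>R - P\<close>. Adding two vertices with this trace
  gives an edge in which \<open>P\<close> is a class.\<close>

lemma class_descent:
  assumes e: "e \<in> E" "u \<in> e" and c2: "2 \<le> card (cls e u)"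
  shows "\<exists>e'\<in>E. \<exists>u'\<in>e'. card (cls e' u') + 2 = card (cls e u)"
proof -
  have fin: "finite e" using finite_edge[OF e(1)] .
  have fc: "finite (cls e u)" using fin by (simp add: cls_def)
  obtain v where v: "v \<in> cls e u" "v \<noteq> u"
  proof -
    have "\<not> cls e u \<subseteq> {u}" using c2 card_mono[of "{u}" "cls e u"] by auto
    then show ?thesis using that by blast
  qed
  have ve: "v \<in> e" using v by (simp add: cls_def)
  let ?R = "e - {u} - {v}"
  have eq: "insert v ?R = e - {u}" using v ve by auto
  have R: "?R \<subseteq> V" "card ?R = k - 2" "v \<in> V - ?R"
    using edge_sub[OF e(1)] card_edge_minus[OF e] fin v ve by auto
  have cls: "cls e u = insert u (act (e - {u}))" by (rule cls_eq_insert_act[OF e])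
  have pv: "pure ?R v" using cls v unfolding pure_def eq by auto
  let ?P = "trace ?R v"
  have clsP: "cls e u = insert u (insert v ?P)" using cls v unfolding trace_def eq by auto
  have "u \<notin> ?P" "v \<notin> ?P" using trace_subset[of ?R v] by auto
  then have cP: "card (cls e u) = card ?P + 2"
    using clsP v finite_subset[OF trace_subset, of ?R v] fin by simp
  obtain y where y: "y \<in> ?R - ?P" using passive_nonempty[OF R pv] by blast
  obtain z where z: "z \<in> V - ?R" "pure ?R z" "y \<in> trace ?R z" using pure_other_trace[OF R pv y] by blast
  have ne: "?P \<noteq> trace ?R z" using y z by blast
  have trz: "trace ?R z = ?R - ?P"
    using passive_subset_other_trace[OF R pv z(1) ne] traces_disjoint[OF R pv z(1) ne] trace_subset[of ?R z]
    by blast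
  obtain w where w: "w \<in> nbrs (insert z ?R)" using ex_nbr card_link[OF R(1,2) z(1)] by blast
  let ?e = "insert w (insert z ?R)"
  note n = nbrsD[OF w card_link(2)[OF R(1,2) z(1)] card_link(1)[OF R(1,2) z(1)]]
  have "?e - {w} = insert z ?R" using n by auto
  then have "cls ?e w = insert w (act (insert z ?R))" using cls_eq_insert_act[OF n(1), of w] by simp
  also have "act (insert z ?R) = insert z (trace ?R z)" using z(2) unfolding pure_def trace_def by blast
  finally have cw: "cls ?e w = insert w (insert z (?R - ?P))" using trz by simp
  obtain t where t: "t \<in> ?e" "\<not> adj ?e w t" using ex_not_adj[OF n(1)] by blast
  then have "cls ?e t = ?e - cls ?e w" using cls_other[OF n(1) t(1), of w] adj_sym by blast
  also have "\<dots> = ?P" using cw trace_subset[of ?R v] n z(1) by auto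
  finally show ?thesis using n(1) t(1) cP by (metis (no_types))
qed

lemma card_cls_pos: "e \<in> E \<Longrightarrow> u \<in> e \<Longrightarrow> 0 < card (cls e u)"
  using adj_refl[of e u] finite_edge[of e] by (auto simp: cls_def card_gt_0_iff)

text \<open>Descending from an even size would end with an empty class.\<close>

lemma odd_card_cls: "e \<in> E \<Longrightarrow> u \<in> e \<Longrightarrow> odd (card (cls e u))"
proof (induction "card (cls e u)" arbitrary: e u rule: less_induct)
  case less
  show ?case
  proof
    assume ev: "even (card (cls e u))"
    then have "2 \<le> card (cls e u)" using card_cls_pos[OF less.prems] by presburger
    then obtain e' u' where "e' \<in> E" "u' \<in> e'" "card (cls e' u') + 2 = card (cls e u)"
      using class_descent less.prems by blast
    then show False using less.hyps[of e' u'] ev by (metis even_add even_numeral less_add_same_cancel1 zero_less_numeral)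
  qed
qed

lemma smaller_odd_class:
  assumes "e \<in> E" "u \<in> e" "odd m" "m \<le> card (cls e u)"
  shows "\<exists>e'\<in>E. \<exists>u'\<in>e'. card (cls e' u') = m"
  using assms
proof (induction "card (cls e u)" arbitrary: e u rule: less_induct)
  case less
  show ?case
  proof (cases "m = card (cls e u)")
    case True then show ?thesis using less.prems by blast
  next
    case False
    then have lt: "m < card (cls e u)" using less.prems by simp
    have "0 < m" using less.prems(3) by (auto intro: Nat.gr0I)
    then have "2 \<le> card (cls e u)" using lt by linarith
    then obtain e' u' where e': "e' \<in> E" "u' \<in> e'" "card (cls e' u') + 2 = card (cls e u)"
      using class_descent less.prems(1,2) by blast
    then have "m \<noteq> card (cls e' u') + 1" using odd_card_cls[OF e'(1,2)] less.prems(3) by auto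
    then show ?thesis using less.hyps[OF _ e'(1,2) less.prems(3)] e'(3) lt by simp
  qed
qed

text \<open>All class sizes are odd and descend to \<open>1\<close>. The class opposite to one of size \<open>1\<close> has size
  \<open>k - 1\<close>, from where all odd sizes below are reached. As \<open>k\<close> is even, the odd number
  \<open>k div gcd k l\<close> is not \<open>k\<close> itself and is one of them; but a class of this size
  yields a closed walk.\<close>

lemma no_edge: "E = {}"
proof (rule ccontr)
  assume "E \<noteq> {}"
  then obtain e where e: "e \<in> E" by blast
  then have "e \<noteq> {}" using card_edge k_pos by fastforce
  then obtain u where u: "u \<in> e" by blast
  obtain e1 u1 where e1: "e1 \<in> E" "u1 \<in> e1" "card (cls e1 u1) = 1"
    using smaller_odd_class[OF e u, of 1] card_cls_pos[OF e u] by auto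
  obtain t where t: "t \<in> e1" "\<not> adj e1 u1 t" using ex_not_adj[OF e1(1,2)] by blast
  have "cls e1 t = e1 - cls e1 u1" using cls_other[OF e1(1) t(1) e1(2)] t(2) adj_sym by blast
  moreover have "cls e1 u1 \<subseteq> e1" by (auto simp: cls_def)
  ultimately have ct: "card (cls e1 t) = k - 1"
    using e1 card_edge[OF e1(1)] finite_subset[OF _ finite_edge[OF e1(1)]] by (simp add: card_Diff_subset)
  let ?q = "k div gcd k l"
  have "odd (k - 1)" using odd_card_cls[OF e1(1) t(1)] ct by simp
  then have "even k" using k_ge_3 by simp
  then have "?q \<noteq> k" using odd_cycles by auto
  moreover have "?q \<le> k" by simp
  ultimately have "?q \<le> card (cls e1 t)" using ct by linarith
  then obtain e2 u2 where e2: "e2 \<in> E" "u2 \<in> e2" "card (cls e2 u2) = ?q"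
    using smaller_odd_class[OF e1(1) t(1) odd_cycles] by blast
  have sub: "cls e2 u2 \<subseteq> e2" by (auto simp: cls_def)
  have sw: "swappable 3 e2 a b" if ab: "a \<in> e2" "b \<in> e2" "a \<in> cls e2 u2 \<longleftrightarrow> b \<in> cls e2 u2" for a b
  proof -
    have "adj e2 a b"
      using ab adj_three[OF e2(1,2) ab(1,2)] adj_trans[OF e2(1)] adj_sym e2(2) unfolding cls_def by blast
    then show ?thesis using adj_swappable[OF e2(1)] ab by blast
  qed
  have "3 * k \<le> l div k" by (rule cost_bound) simp
  from closed_tight_walk_if_class_swappable[OF e2(1) sub e2(3) sw this k_less_l]
  show False using no_walk_Union by contradiction
qed

end

theorem (in dense_family) closed_tight_walk_exists:
  assumes "k - 1 \<le> card V" "k < l" "20 * k ^ 2 \<le> l" "odd (k div gcd k l)"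
  shows "\<exists>f. closed_tight_walk l f \<and> f ` {..<l} \<subseteq> V"
proof (rule ccontr)
  assume "\<not> ?thesis"
  then interpret dense_family_without_walk E k V l
    by unfold_locales (use assms in auto)
  obtain S where "S \<subseteq> V" "card S = k - 1"
    using assms(1) obtain_subset_with_card_n by metis
  then obtain w where "w \<in> nbrs S" using ex_nbr by blast
  then have "insert w S \<in> E" unfolding nbrs_def by blast
  then show False using no_edge by blast
qed

section \<open>Random samples keep the codegrees\<close>

text \<open>An exponential moment: weight each function by \<open>(1 + \<eta>)\<close> to the number of misses and sum over
  all functions, which factorises.\<close>

lemma card_functions_with_many_misses:
  fixes V :: "'a set" and J :: "'i set"
  assumes fin: "finite J" "finite V" and N: "N \<subseteq> V" and \<eta>: "0 \<le> (\<eta>::real)"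
  shows "real (card {h \<in> PiE J (\<lambda>_. V). \<tau> \<le> card {i \<in> J. h i \<notin> N}}) * (1 + \<eta>) ^ \<tau>
     \<le> (real (card V) + \<eta> * (real (card V) - real (card N))) ^ card J"
proof -
  let ?X = "PiE J (\<lambda>_. V)" and ?wt = "\<lambda>x. if x \<in> N then 1 else 1 + \<eta>"
  let ?B = "{h \<in> ?X. \<tau> \<le> card {i \<in> J. h i \<notin> N}}"
  have finX: "finite ?X" using fin by (intro finite_PiE) auto
  have wt: "(\<Prod>i\<in>J. ?wt (h i)) = (1 + \<eta>) ^ card {i \<in> J. h i \<notin> N}" for h
  proof -
    have "{i \<in> J. h i \<notin> N} = J \<inter> - {i. h i \<in> N}" by auto
    then show ?thesis using fin by (simp add: prod.If_cases)
  qed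
  have "real (card ?B) * (1 + \<eta>) ^ \<tau> = (\<Sum>h\<in>?B. (1 + \<eta>) ^ \<tau>)" by simp
  also have "\<dots> \<le> (\<Sum>h\<in>?B. \<Prod>i\<in>J. ?wt (h i))"
    unfolding wt using \<eta> by (intro sum_mono power_increasing) auto
  also have "\<dots> \<le> (\<Sum>h\<in>?X. \<Prod>i\<in>J. ?wt (h i))"
    using finX \<eta> by (intro sum_mono2 prod_nonneg) auto
  also have "\<dots> = (\<Prod>i\<in>J. \<Sum>x\<in>V. ?wt x)"
    using fin by (subst prod_sum_PiE) auto
  also have "\<dots> = (\<Sum>x\<in>V. ?wt x) ^ card J" by simp
  also have "(\<Sum>x\<in>V. ?wt x) = real (card V) + \<eta> * (real (card V) - real (card N))"
  proof -
    have "(\<Sum>x\<in>V. ?wt x) = (\<Sum>x\<in>V. (1 + \<eta>) - (if x \<in> N then \<eta> else 0))"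
      by (intro sum.cong) auto
    also have "\<dots> = (1 + \<eta>) * real (card V) - \<eta> * real (card N)"
      using fin N by (simp add: sum_subtractf sum.If_cases Int_absorb1)
    finally show ?thesis by (simp add: algebra_simps)
  qed
  finally show ?thesis .
qed

text \<open>The target set \<open>N g\<close> of the samples outside \<open>S\<close> depends on the samples \<open>g\<close> on \<open>S\<close>. Conditioning
  on \<open>g\<close> reduces this to \<open>card_functions_with_many_misses\<close>. The samples on \<open>S\<close> may all be misses,
  which costs the factor \<open>2 ^ card S\<close>.\<close>

lemma card_functions_with_few_hits:
  fixes V :: "'a set" and I S :: "'i set" and N :: "('i \<Rightarrow> 'a) \<Rightarrow> 'a set"
  assumes fin: "finite I" "finite V" and S: "S \<subseteq> I" and n: "0 < card V"
    and \<gamma>: "0 \<le> \<gamma>" "\<gamma> \<le> 1" and \<epsilon>: "0 < \<epsilon>" "\<epsilon> \<le> 1"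
    and A: "A \<subseteq> PiE S (\<lambda>_. V)"
    and N: "\<And>g. g \<in> A \<Longrightarrow> N g \<subseteq> V \<and> \<gamma> * real (card V) \<le> real (card (N g))"
  shows "real (card {f \<in> PiE I (\<lambda>_. V). restrict f S \<in> A \<and>
        real (card {i \<in> I. f i \<in> N (restrict f S)}) < (\<gamma> - \<epsilon>) * real (card I)})
     \<le> 2 ^ card S * exp (- (\<epsilon>\<^sup>2 * real (card I) / 8)) * real (card V) ^ card I"
    (is "real (card ?Bad) \<le> _")
proof -
  define n where "n = real (card V)"
  define m where "m = real (card I)"
  \<comment> \<open>minimises the exponent \<open>- \<epsilon> \<eta> + 2 \<eta>\<^sup>2\<close> that arises below\<close>
  define \<eta> where "\<eta> = \<epsilon> / 4"
  define J where "J = I - S"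
  define x where "x = (1 - \<gamma> + \<epsilon>) * m"
  define \<tau> where "\<tau> = nat \<lceil>x\<rceil> - card S"
  define H where "H g = {h \<in> PiE J (\<lambda>_. V). \<tau> \<le> card {i \<in> J. h i \<notin> N g}}" for g
  define K where "K = 2 ^ card S * exp (- (\<epsilon>\<^sup>2 * m / 8)) * n ^ card J"
  have n0: "0 < n" using n by (simp add: n_def)
  have m0: "0 \<le> m" by (simp add: m_def)
  have x0: "0 \<le> x" using \<gamma> \<epsilon> m0 by (simp add: x_def)
  have \<eta>: "0 \<le> \<eta>" "\<eta> \<le> 1" using \<epsilon> by (auto simp: \<eta>_def)
  have finS: "finite S" "finite J" using S fin finite_subset by (auto simp: J_def)
  have cI: "card I = card S + card J"
    using S fin finS card_mono[OF fin(1) S] by (simp add: J_def card_Diff_subset)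
  have H_bound: "real (card (H g)) \<le> K" if g: "g \<in> A" for g
  proof -
    have "real (card (H g)) * (1 + \<eta>) ^ \<tau> \<le> (n + \<eta> * (n - real (card (N g)))) ^ card J"
      unfolding H_def n_def using finS fin N[OF g] \<eta> by (intro card_functions_with_many_misses) auto
    also have "\<dots> \<le> (n * (1 + \<eta> * (1 - \<gamma>))) ^ card J"
    proof (rule power_mono)
      have "\<eta> * (n - real (card (N g))) \<le> \<eta> * (n - \<gamma> * n)"
        using N[OF g] \<eta> by (intro mult_left_mono) (auto simp: n_def)
      then show "n + \<eta> * (n - real (card (N g))) \<le> n * (1 + \<eta> * (1 - \<gamma>))"
        by (simp add: algebra_simps)
      have "card (N g) \<le> card V" using N[OF g] fin by (intro card_mono) auto
      then show "0 \<le> n + \<eta> * (n - real (card (N g)))"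
        using \<eta> n0 by (simp add: n_def)
    qed
    also have "\<dots> = n ^ card J * (1 + \<eta> * (1 - \<gamma>)) ^ card J" by (simp add: power_mult_distrib)
    also have "\<dots> \<le> n ^ card J * exp (\<eta> * (1 - \<gamma>) * m)"
    proof (rule mult_left_mono)
      have nn: "0 \<le> \<eta> * (1 - \<gamma>)" using \<eta> \<gamma> by simp
      have "(1 + \<eta> * (1 - \<gamma>)) ^ card J \<le> exp (\<eta> * (1 - \<gamma>)) ^ card J"
        using nn by (intro power_mono exp_ge_add_one_self) auto
      also have "\<dots> = exp (\<eta> * (1 - \<gamma>) * real (card J))"
        by (simp add: exp_of_nat_mult[symmetric] mult.commute)
      also have "\<dots> \<le> exp (\<eta> * (1 - \<gamma>) * m)"
        using nn cI by (auto simp: m_def intro!: mult_left_mono)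
      finally show "(1 + \<eta> * (1 - \<gamma>)) ^ card J \<le> exp (\<eta> * (1 - \<gamma>) * m)" .
    qed (use n0 in auto)
    finally have up: "real (card (H g)) * (1 + \<eta>) ^ \<tau> \<le> n ^ card J * exp (\<eta> * (1 - \<gamma>) * m)" .
    have low: "exp (x * (\<eta> - \<eta>\<^sup>2)) \<le> (1 + \<eta>) ^ \<tau> * 2 ^ card S"
    proof -
      have "x * (\<eta> - \<eta>\<^sup>2) \<le> x * ln (1 + \<eta>)"
        using x0 \<eta> by (intro mult_left_mono ln_one_plus_pos_lower_bound) auto
      also have "\<dots> \<le> real (nat \<lceil>x\<rceil>) * ln (1 + \<eta>)"
        using \<eta> x0 by (intro mult_right_mono real_nat_ceiling_ge) auto
      finally have "exp (x * (\<eta> - \<eta>\<^sup>2)) \<le> exp (real (nat \<lceil>x\<rceil>) * ln (1 + \<eta>))" by simp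
      also have "\<dots> = (1 + \<eta>) ^ nat \<lceil>x\<rceil>"
        using \<eta> by (simp add: exp_of_nat_mult)
      also have "\<dots> \<le> (1 + \<eta>) ^ (\<tau> + card S)"
      proof (rule power_increasing)
        show "nat \<lceil>x\<rceil> \<le> \<tau> + card S" unfolding \<tau>_def by arith
      qed (use \<eta> in simp)
      also have "\<dots> \<le> (1 + \<eta>) ^ \<tau> * 2 ^ card S"
        unfolding power_add using \<eta> by (intro mult_left_mono power_mono) auto
      finally show ?thesis .
    qed
    have "real (card (H g)) * exp (x * (\<eta> - \<eta>\<^sup>2)) \<le> real (card (H g)) * ((1 + \<eta>) ^ \<tau> * 2 ^ card S)"
      using low by (intro mult_left_mono) auto
    also have "\<dots> \<le> n ^ card J * exp (\<eta> * (1 - \<gamma>) * m) * 2 ^ card S"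
      using mult_right_mono[OF up, of "2 ^ card S"] by (simp add: mult.assoc)
    finally have "real (card (H g)) \<le> n ^ card J * exp (\<eta> * (1 - \<gamma>) * m) * 2 ^ card S / exp (x * (\<eta> - \<eta>\<^sup>2))"
      by (simp add: pos_le_divide_eq)
    also have "\<dots> = n ^ card J * 2 ^ card S * exp (\<eta> * (1 - \<gamma>) * m - x * (\<eta> - \<eta>\<^sup>2))"
      by (simp add: exp_diff)
    also have "\<dots> \<le> n ^ card J * 2 ^ card S * exp (- (\<epsilon>\<^sup>2 * m / 8))"
    proof -
      have "\<eta> * (1 - \<gamma>) * m - x * (\<eta> - \<eta>\<^sup>2) = m * (- \<epsilon> * \<eta> + (1 - \<gamma> + \<epsilon>) * \<eta>\<^sup>2)"
        by (simp add: x_def algebra_simps power2_eq_square)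
      also have "\<dots> \<le> m * (- \<epsilon> * \<eta> + 2 * \<eta>\<^sup>2)"
        using \<gamma> \<epsilon> m0 by (intro mult_left_mono add_left_mono mult_right_mono) auto
      also have "\<dots> = - (\<epsilon>\<^sup>2 * m / 8)" by (simp add: \<eta>_def power2_eq_square field_simps)
      finally show ?thesis using n0 by (intro mult_left_mono) auto
    qed
    finally show ?thesis by (simp add: K_def mult.commute mult.left_commute)
  qed
  have finX: "finite (PiE I (\<lambda>_. V))" using fin by (intro finite_PiE) auto
  have finA: "finite A" by (rule finite_subset[OF A]) (use finS fin in \<open>auto intro: finite_PiE\<close>)
  have finH: "finite (H g)" for g
    unfolding H_def using finS fin by (auto intro!: finite_PiE)
  have inj: "inj_on (\<lambda>f. (restrict f S, restrict f J)) (PiE I (\<lambda>_. V))"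
  proof (rule inj_onI)
    fix f f' assume f: "f \<in> PiE I (\<lambda>_. V)" "f' \<in> PiE I (\<lambda>_. V)"
      and eq: "(restrict f S, restrict f J) = (restrict f' S, restrict f' J)"
    show "f = f'"
    proof (rule PiE_ext[OF f])
      fix i assume "i \<in> I"
      then show "f i = f' i" using eq by (cases "i \<in> S") (auto simp: J_def restrict_def fun_eq_iff split: if_splits)
    qed
  qed
  have "(\<lambda>f. (restrict f S, restrict f J)) ` ?Bad \<subseteq> Sigma A H"
  proof clarify
    fix f assume f: "f \<in> PiE I (\<lambda>_. V)" "restrict f S \<in> A"
      and few: "real (card {i \<in> I. f i \<in> N (restrict f S)}) < (\<gamma> - \<epsilon>) * real (card I)"
    let ?N = "N (restrict f S)"
    have "restrict f J \<in> PiE J (\<lambda>_. V)" using f by (auto simp: J_def)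
    moreover have "\<tau> \<le> card {i \<in> J. restrict f J i \<notin> ?N}"
    proof -
      have "{i \<in> J. restrict f J i \<notin> ?N} = J - {i \<in> J. f i \<in> ?N}" by auto
      then have "card {i \<in> J. restrict f J i \<notin> ?N} = card J - card {i \<in> J. f i \<in> ?N}"
        using finS by (simp add: card_Diff_subset)
      moreover have "card {i \<in> J. f i \<in> ?N} \<le> card {i \<in> I. f i \<in> ?N}"
        using fin by (intro card_mono) (auto simp: J_def)
      moreover have "card {i \<in> J. f i \<in> ?N} \<le> card J" using finS by (intro card_mono) auto
      ultimately have "x < real (card {i \<in> J. restrict f J i \<notin> ?N} + card S)"
        using few cI by (simp add: x_def m_def algebra_simps of_nat_diff)
      then show ?thesis unfolding \<tau>_def by linarith
    qed
    ultimately show "restrict f J \<in> H (restrict f S)" by (simp add: H_def)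
  qed
  moreover have "inj_on (\<lambda>f. (restrict f S, restrict f J)) ?Bad"
    by (rule inj_on_subset[OF inj]) blast
  moreover have "finite (Sigma A H)" using finA finH by (intro finite_SigmaI)
  ultimately have "card ?Bad \<le> card (Sigma A H)" by (intro card_inj_on_le)
  also have "\<dots> = (\<Sum>g\<in>A. card (H g))" using finA finH by simp
  finally have "real (card ?Bad) \<le> (\<Sum>g\<in>A. real (card (H g)))"
    unfolding of_nat_sum[symmetric] of_nat_le_iff .
  also have "\<dots> \<le> real (card A) * K" using H_bound by (rule sum_bounded_above)
  also have "\<dots> \<le> n ^ card S * K"
  proof (rule mult_right_mono)
    have "card A \<le> card (PiE S (\<lambda>_. V))" using A finS fin by (intro card_mono finite_PiE) auto
    also have "\<dots> = card V ^ card S" using finS by (simp add: card_funcsetE)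
    finally show "real (card A) \<le> n ^ card S" unfolding n_def of_nat_power[symmetric] of_nat_le_iff .
  qed (use n0 in \<open>auto simp: K_def\<close>)
  also have "\<dots> = 2 ^ card S * exp (- (\<epsilon>\<^sup>2 * m / 8)) * n ^ card I"
    by (simp add: K_def cI power_add)
  finally show ?thesis by (simp add: n_def m_def)
qed

lemma card_noninjective_functions:
  fixes V :: "'a set"
  assumes "finite V" "finite (I :: 'i set)"
  shows "card {f \<in> PiE I (\<lambda>_. V). \<not> inj_on f I} \<le> card I ^ 2 * card V ^ (card I - 1)"
proof -
  let ?X = "PiE I (\<lambda>_. V)"
  let ?D = "{(a, b). a \<in> I \<and> b \<in> I \<and> a \<noteq> b}"
  let ?C = "\<lambda>(a, b). {f \<in> ?X. f a = f b}"
  have finX: "finite ?X" using assms by (intro finite_PiE) auto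
  have finD: "finite ?D" by (rule finite_subset[of _ "I \<times> I"]) (use assms in auto)
  have one: "card (?C p) \<le> card V ^ (card I - 1)" if "p \<in> ?D" for p
  proof -
    obtain a b where p: "p = (a, b)" "a \<in> I" "b \<in> I" "a \<noteq> b"
      using \<open>p \<in> ?D\<close> by (cases p) auto
    have "inj_on (\<lambda>f. restrict f (I - {a})) {f \<in> ?X. f a = f b}"
    proof (rule inj_onI)
      fix f f' assume f: "f \<in> {f \<in> ?X. f a = f b}" "f' \<in> {f \<in> ?X. f a = f b}"
        and eq: "restrict f (I - {a}) = restrict f' (I - {a})"
      have off: "f i = f' i" if "i \<in> I - {a}" for i
        using fun_cong[OF eq, of i] that by simp
      show "f = f'"
      proof (rule PiE_ext)
        show "f \<in> ?X" "f' \<in> ?X" using f by auto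
        fix i assume "i \<in> I"
        then show "f i = f' i" using off[of i] off[of b] f p by (cases "i = a") auto
      qed
    qed
    moreover have "(\<lambda>f. restrict f (I - {a})) ` {f \<in> ?X. f a = f b} \<subseteq> PiE (I - {a}) (\<lambda>_. V)"
    proof clarify
      fix f assume "f \<in> ?X"
      then show "restrict f (I - {a}) \<in> PiE (I - {a}) (\<lambda>_. V)" by (intro PiE_I) auto
    qed
    moreover have "finite (PiE (I - {a}) (\<lambda>_. V))" using assms by (intro finite_PiE) auto
    ultimately have "card (?C p) \<le> card (PiE (I - {a}) (\<lambda>_. V))"
      unfolding p(1) prod.case by (rule card_inj_on_le)
    also have "\<dots> = card V ^ (card I - 1)" using assms p by (simp add: card_funcsetE)
    finally show ?thesis .
  qed
  have "{f \<in> ?X. \<not> inj_on f I} \<subseteq> (\<Union>p\<in>?D. ?C p)" by (auto simp: inj_on_def)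
  then have "card {f \<in> ?X. \<not> inj_on f I} \<le> card (\<Union>p\<in>?D. ?C p)"
    using finX finD by (intro card_mono finite_UN_I) auto
  also have "\<dots> \<le> (\<Sum>p\<in>?D. card (?C p))" using finD by (rule card_UN_le)
  also have "\<dots> \<le> of_nat (card ?D) * card V ^ (card I - 1)" by (rule sum_bounded_above) (rule one)
  also have "\<dots> \<le> card I ^ 2 * card V ^ (card I - 1)"
  proof -
    have "card ?D \<le> card (I \<times> I)" using assms by (intro card_mono) auto
    then show ?thesis
      unfolding of_nat_id power2_eq_square card_cartesian_product by (rule mult_right_mono) simp
  qed
  finally show ?thesis .
qed

text \<open>Union bound over non-injective samples and over all sets \<open>S\<close> of \<open>r\<close> sample points; the number
  of the latter is polynomial in \<open>m\<close>, while each of them fails with exponentially small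
  probability. The threshold \<open>M\<close> must not depend on the host.\<close>

lemma most_samples_keep_codegree:
  assumes \<epsilon>: "0 < \<epsilon>" "\<epsilon> \<le> 1"
  shows "\<exists>M. \<forall>m (V :: 'a set) E \<gamma>. M \<le> m \<longrightarrow> finite V \<longrightarrow> 4 * m\<^sup>2 \<le> card V \<longrightarrow> 0 \<le> \<gamma> \<longrightarrow> \<gamma> \<le> 1 \<longrightarrow>
     (\<forall>S\<subseteq>V. card S = r \<longrightarrow> \<gamma> * real (card V) \<le> real (card {w \<in> V. insert w S \<in> E})) \<longrightarrow>
     real (card V) ^ m \<le> 2 * real (card {f \<in> PiE {..<m} (\<lambda>_. V). inj_on f {..<m} \<and>
        (\<forall>S\<subseteq>{..<m}. card S = r \<longrightarrow> (\<gamma> - \<epsilon>) * real m \<le> real (card {i \<in> {..<m}. insert (f i) (f ` S) \<in> E}))})"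
proof -
  define c where "c = \<epsilon>\<^sup>2 / 8"
  have c: "0 < c" using \<epsilon> by (simp add: c_def)
  have "((\<lambda>x::real. x ^ r / exp x) \<longlongrightarrow> 0) at_top" by (rule tendsto_power_div_exp_0)
  moreover have "filterlim (\<lambda>m. c * real m) at_top sequentially"
    using c by (rule filterlim_tendsto_pos_mult_at_top[OF tendsto_const _ filterlim_real_sequentially])
  ultimately have "(\<lambda>m. (c * real m) ^ r / exp (c * real m)) \<longlonglongrightarrow> 0"
    by (rule filterlim_compose)
  moreover have "0 < c ^ r / (4 * 2 ^ r)" using c by simp
  ultimately have "\<forall>\<^sub>F m in sequentially. (c * real m) ^ r / exp (c * real m) < c ^ r / (4 * 2 ^ r)"
    by (rule order_tendstoD(2))
  then obtain M0 where M0: "\<And>m. M0 \<le> m \<Longrightarrow> (c * real m) ^ r / exp (c * real m) < c ^ r / (4 * 2 ^ r)"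
    by (auto simp: eventually_sequentially)
  have small: "real m ^ r * (2 ^ r * exp (- (\<epsilon>\<^sup>2 * real m / 8))) \<le> 1 / 4" if "M0 \<le> m" for m
  proof -
    have "c ^ r * (real m ^ r / exp (c * real m)) < c ^ r * (1 / (4 * 2 ^ r))"
      using M0[OF that] by (simp add: power_mult_distrib)
    moreover have "0 < c ^ r" using c by simp
    ultimately have "real m ^ r / exp (c * real m) < 1 / (4 * 2 ^ r)"
      by (simp only: mult_less_cancel_left_pos)
    then have "real m ^ r / exp (c * real m) * 2 ^ r < 1 / 4" by (simp add: field_simps)
    moreover have "exp (- (\<epsilon>\<^sup>2 * real m / 8)) = 1 / exp (c * real m)"
      by (simp add: c_def exp_minus inverse_eq_divide)
    ultimately show ?thesis by (simp add: mult.commute mult.left_commute)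
  qed
  show ?thesis
  proof (intro exI[of _ "max M0 1"] allI impI)
    fix m and V :: "'a set" and E \<gamma>
    assume m: "max M0 1 \<le> m" and fin: "finite V" and big: "4 * m\<^sup>2 \<le> card V" and \<gamma>: "0 \<le> \<gamma>" "\<gamma> \<le> 1"
      and codeg: "\<forall>S\<subseteq>V. card S = r \<longrightarrow> \<gamma> * real (card V) \<le> real (card {w \<in> V. insert w S \<in> E})"
    define n where "n = real (card V)"
    have m1: "1 \<le> m" "M0 \<le> m" using m by auto
    then have n0: "0 < card V" using big by (auto intro: Nat.gr0I)
    let ?X = "PiE {..<m} (\<lambda>_. V)"
    let ?hits = "\<lambda>f S. {i \<in> {..<m}. insert (f i) (f ` S) \<in> E}"
    let ?G = "{f \<in> ?X. inj_on f {..<m} \<and> (\<forall>S\<subseteq>{..<m}. card S = r \<longrightarrow> (\<gamma> - \<epsilon>) * real m \<le> real (card (?hits f S)))}"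
    let ?NI = "{f \<in> ?X. \<not> inj_on f {..<m}}"
    let ?\<S> = "{S. S \<subseteq> {..<m} \<and> card S = r}"
    let ?A = "\<lambda>S. {g \<in> PiE S (\<lambda>_. V). inj_on g S}"
    let ?N = "\<lambda>S g. {w \<in> V. insert w (g ` S) \<in> E}"
    let ?Bad = "\<lambda>S. {f \<in> ?X. restrict f S \<in> ?A S \<and>
      real (card {i \<in> {..<m}. f i \<in> ?N S (restrict f S)}) < (\<gamma> - \<epsilon>) * real (card {..<m})}"
    have finX: "finite ?X" using fin by (intro finite_PiE) auto
    have finS: "finite ?\<S>" by simp
    have cX: "card ?X = card V ^ m" by (simp add: card_funcsetE)
    have NI: "real (card ?NI) \<le> n ^ m / 4"
    proof -
      have "4 * card ?NI \<le> 4 * (m\<^sup>2 * card V ^ (m - 1))"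
        using card_noninjective_functions[OF fin, of "{..<m}"] by simp
      also have "\<dots> \<le> card V * card V ^ (m - 1)"
        using mult_le_mono1[OF big, of "card V ^ (m - 1)"] by (simp add: mult.assoc)
      also have "\<dots> = card V ^ m" using m1 by (simp add: power_eq_if)
      finally have "real (4 * card ?NI) \<le> real (card V ^ m)" by (simp only: of_nat_le_iff)
      then show ?thesis by (simp add: n_def)
    qed
    have Bad: "real (card (?Bad S)) \<le> 2 ^ r * exp (- (\<epsilon>\<^sup>2 * real m / 8)) * n ^ m" if S: "S \<in> ?\<S>" for S
    proof -
      have "real (card (?Bad S)) \<le> 2 ^ card S * exp (- (\<epsilon>\<^sup>2 * real (card {..<m}) / 8)) * real (card V) ^ card {..<m}"
      proof (rule card_functions_with_few_hits[OF _ fin _ n0 \<gamma> \<epsilon>])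
        fix g assume g: "g \<in> ?A S"
        have "g ` S \<subseteq> V" "card (g ` S) = r" using g S by (auto simp: card_image)
        then show "?N S g \<subseteq> V \<and> \<gamma> * real (card V) \<le> real (card (?N S g))" using codeg by auto
      qed (use S in auto)
      then show ?thesis using S by (simp add: n_def)
    qed
    have sub: "?X \<subseteq> ?G \<union> ?NI \<union> (\<Union>S\<in>?\<S>. ?Bad S)"
    proof
      fix f assume f: "f \<in> ?X"
      show "f \<in> ?G \<union> ?NI \<union> (\<Union>S\<in>?\<S>. ?Bad S)"
      proof (rule ccontr)
        assume n: "f \<notin> ?G \<union> ?NI \<union> (\<Union>S\<in>?\<S>. ?Bad S)"
        then have inj: "inj_on f {..<m}" using f by blast
        then obtain S where S: "S \<subseteq> {..<m}" "card S = r" "\<not> (\<gamma> - \<epsilon>) * real m \<le> real (card (?hits f S))"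
          using n f by blast
        have im: "restrict f S ` S = f ` S" by simp
        have "restrict f S \<in> ?A S" using f S(1) inj by (auto simp: inj_on_def)
        moreover have "{i \<in> {..<m}. f i \<in> ?N S (restrict f S)} = ?hits f S"
          unfolding im using f by auto
        ultimately have "f \<in> ?Bad S" using f S(3) by simp
        then show False using n S by blast
      qed
    qed
    have "card ?X \<le> card (?G \<union> ?NI \<union> (\<Union>S\<in>?\<S>. ?Bad S))"
      using sub finX finS by (intro card_mono finite_UnI finite_UN_I) auto
    also have "\<dots> \<le> card ?G + card ?NI + card (\<Union>S\<in>?\<S>. ?Bad S)"
      by (intro order_trans[OF card_Un_le] add_right_mono card_Un_le)
    also have "\<dots> \<le> card ?G + card ?NI + (\<Sum>S\<in>?\<S>. card (?Bad S))"
      using card_UN_le[OF finS] by (intro add_left_mono) blast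
    finally have "real (card ?X) \<le> real (card ?G + card ?NI + (\<Sum>S\<in>?\<S>. card (?Bad S)))"
      by (simp only: of_nat_le_iff)
    then have 1: "n ^ m \<le> real (card ?G) + real (card ?NI) + (\<Sum>S\<in>?\<S>. real (card (?Bad S)))"
      by (simp only: cX of_nat_add of_nat_sum of_nat_power n_def)
    have "(\<Sum>S\<in>?\<S>. real (card (?Bad S))) \<le> real (card ?\<S>) * (2 ^ r * exp (- (\<epsilon>\<^sup>2 * real m / 8)) * n ^ m)"
      using Bad by (rule sum_bounded_above)
    also have "\<dots> \<le> real m ^ r * (2 ^ r * exp (- (\<epsilon>\<^sup>2 * real m / 8)) * n ^ m)"
    proof (rule mult_right_mono)
      have "card ?\<S> = m choose r" using n_subsets[of "{..<m}" r] by simp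
      also have "\<dots> \<le> m ^ r" by (cases "r \<le> m") (simp_all add: binomial_le_pow binomial_eq_0)
      finally show "real (card ?\<S>) \<le> real m ^ r" unfolding of_nat_power[symmetric] of_nat_le_iff .
    qed (simp add: n_def)
    also have "\<dots> = real m ^ r * (2 ^ r * exp (- (\<epsilon>\<^sup>2 * real m / 8))) * n ^ m" by (simp add: mult.assoc)
    also have "\<dots> \<le> 1 / 4 * n ^ m" using small[OF m1(2)] by (rule mult_right_mono) (simp add: n_def)
    finally show "real (card V) ^ m \<le> 2 * real (card ?G)" using 1 NI by (simp add: n_def)
  qed
qed

section \<open>Boxes in dense sets of functions\<close>

lemma pigeonhole_relation:
  fixes A :: "'a set" and B :: "'b set"
  assumes fin: "finite A" "finite B" and rel: "\<And>a. a \<in> A \<Longrightarrow> \<exists>b\<in>B. P a b" and ne: "B \<noteq> {}"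
  shows "\<exists>b\<in>B. real (card A) \<le> real (card B) * real (card {a \<in> A. P a b})"
proof (rule ccontr)
  assume contr: "\<not> ?thesis"
  have less: "real (card B) * real (card {a \<in> A. P a b}) < real (card A)" if "b \<in> B" for b
  proof (rule ccontr)
    assume "\<not> ?thesis"
    then have "real (card A) \<le> real (card B) * real (card {a \<in> A. P a b})" by (simp only: not_less)
    then have "\<exists>b\<in>B. real (card A) \<le> real (card B) * real (card {a \<in> A. P a b})" using that by (rule bexI)
    with contr show False by contradiction
  qed
  have cB: "0 < real (card B)" using fin ne by (simp add: card_gt_0_iff)
  have "A = (\<Union>b\<in>B. {a \<in> A. P a b})" using rel by blast
  then have "card A \<le> (\<Sum>b\<in>B. card {a \<in> A. P a b})"
    using card_UN_le[OF fin(2), of "\<lambda>b. {a \<in> A. P a b}"] by simp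
  then have "real (card A) \<le> real (\<Sum>b\<in>B. card {a \<in> A. P a b})" by (simp only: of_nat_le_iff)
  then have "real (card B) * real (card A) \<le> real (card B) * (\<Sum>b\<in>B. real (card {a \<in> A. P a b}))"
    using cB by (simp add: mult_left_mono)
  also have "\<dots> = (\<Sum>b\<in>B. real (card B) * real (card {a \<in> A. P a b}))" by (rule sum_distrib_left)
  also have "\<dots> < (\<Sum>b\<in>B. real (card A))" using fin ne less by (intro sum_strict_mono) auto
  finally show False by simp
qed

text \<open>The theorem of Erdos on complete \<open>m\<close>-partite subgraphs of dense \<open>m\<close>-uniform hypergraphs. In the
  induction step, a set \<open>U\<close> of bounded size is chosen among the values of the last coordinate that
  extend many functions; many functions are then extended by \<open>t\<close> elements of \<open>U\<close>, and by the
  pigeonhole principle many of them by the same \<open>t\<close> elements.\<close>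

lemma dense_set_of_functions_contains_box:
  assumes "0 < (c::real)"
  shows "\<exists>N. \<forall>(V :: 'a set) A. finite V \<longrightarrow> N \<le> card V \<longrightarrow> A \<subseteq> PiE {..<m} (\<lambda>_. V) \<longrightarrow>
     c * real (card V) ^ m \<le> real (card A) \<longrightarrow>
     (\<exists>W. (\<forall>i<m. W i \<subseteq> V \<and> card (W i) = t) \<and> PiE {..<m} W \<subseteq> A)"
  using assms
proof (induction m arbitrary: c)
  case 0
  have "PiE {..<0} W \<subseteq> A" if "A \<subseteq> PiE {..<0::nat} (\<lambda>_. V)" "c * real (card V) ^ 0 \<le> real (card A)"
    for V :: "'a set" and W A
  proof -
    have "A \<noteq> {}" using that(2) 0 by auto
    then show ?thesis using that(1) by auto
  qed
  then show ?case by (intro exI[of _ 0] allI impI exI[of _ undefined] conjI) auto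
next
  case (Suc m)
  \<comment> \<open>large enough that \<open>U\<close> retains density when functions with fewer than \<open>t\<close> extensions are
    discarded\<close>
  define u where "u = nat \<lceil>4 * real t / c\<rceil> + 1"
  have u: "4 * real t \<le> c * real u" "0 < u"
  proof -
    have "4 * real t / c \<le> real u" unfolding u_def by linarith
    then show "4 * real t \<le> c * real u" using Suc.prems by (simp add: field_simps)
  qed (simp add: u_def)
  \<comment> \<open>a quarter of the density survives, and there are \<open>2 ^ u\<close> candidates for the common set\<close>
  define c' where "c' = c / 4 / 2 ^ u"
  have "0 < c'" using Suc.prems by (simp add: c'_def)
  from Suc.IH[OF this] obtain N where N:
    "\<And>(V :: 'a set) A. finite V \<Longrightarrow> N \<le> card V \<Longrightarrow> A \<subseteq> PiE {..<m} (\<lambda>_. V) \<Longrightarrow>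
     c' * real (card V) ^ m \<le> real (card A) \<Longrightarrow>
     (\<exists>W. (\<forall>i<m. W i \<subseteq> V \<and> card (W i) = t) \<and> PiE {..<m} W \<subseteq> A)"
    by metis
  show ?case
  proof (intro exI[of _ "max N (nat \<lceil>2 * real u / c\<rceil> + 1)"] allI impI)
    fix V :: "'a set" and A
    assume fin: "finite V" and big: "max N (nat \<lceil>2 * real u / c\<rceil> + 1) \<le> card V"
      and A: "A \<subseteq> PiE {..<Suc m} (\<lambda>_. V)" "c * real (card V) ^ Suc m \<le> real (card A)"
    define n where "n = real (card V)"
    have n0: "0 < n" using big by (simp add: n_def)
    have nu: "2 * real u \<le> c * n"
    proof -
      have "nat \<lceil>2 * real u / c\<rceil> + 1 \<le> card V" using big by simp
      then have "2 * real u / c \<le> n" unfolding n_def by linarith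
      then show ?thesis using Suc.prems by (simp add: field_simps)
    qed
    let ?X = "PiE {..<m} (\<lambda>_. V)"
    define F where "F x = {y \<in> ?X. y(m := x) \<in> A}" for x
    have finX: "finite ?X" using fin by (intro finite_PiE) auto
    have cX: "real (card ?X) = n ^ m" by (simp add: card_funcsetE n_def)
    have finF: "finite (F x)" for x using finX by (simp add: F_def)
    have F_le: "real (card (F x)) \<le> n ^ m" for x
      unfolding cX[symmetric] using finX by (auto simp: F_def intro!: card_mono)
    have split: "restrict f {..<m} \<in> F (f m) \<and> (restrict f {..<m})(m := f m) = f \<and> f m \<in> V" if "f \<in> A" for f
    proof -
      have f: "f \<in> PiE {..<Suc m} (\<lambda>_. V)" using A that by blast
      have eq: "(restrict f {..<m})(m := f m) = f"
      proof
        fix i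
        show "((restrict f {..<m})(m := f m)) i = f i"
          using PiE_arb[OF f, of i] by (cases i m rule: linorder_cases) auto
      qed
      have "restrict f {..<m} \<in> ?X" by (rule PiE_I) (use PiE_mem[OF f] in auto)
      then show ?thesis using eq that PiE_mem[OF f, of m] unfolding F_def by simp
    qed
    have "A \<subseteq> (\<Union>x\<in>V. (\<lambda>y. y(m := x)) ` F x)"
    proof
      fix f assume "f \<in> A"
      from split[OF this] have s: "restrict f {..<m} \<in> F (f m)" "(restrict f {..<m})(m := f m) = f" "f m \<in> V"
        by blast+
      have "(restrict f {..<m})(m := f m) \<in> (\<lambda>y. y(m := f m)) ` F (f m)" using s(1) by (rule imageI)
      then have "f \<in> (\<lambda>y. y(m := f m)) ` F (f m)" unfolding s(2) .
      then show "f \<in> (\<Union>x\<in>V. (\<lambda>y. y(m := x)) ` F x)" by (rule UN_I[OF s(3)])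
    qed
    then have "card A \<le> card (\<Union>x\<in>V. (\<lambda>y. y(m := x)) ` F x)"
      using fin finF by (intro card_mono finite_UN_I finite_imageI) auto
    also have "\<dots> \<le> (\<Sum>x\<in>V. card ((\<lambda>y. y(m := x)) ` F x))" using fin by (rule card_UN_le)
    also have "\<dots> \<le> (\<Sum>x\<in>V. card (F x))" using finF by (intro sum_mono card_image_le) auto
    finally have "real (card A) \<le> (\<Sum>x\<in>V. real (card (F x)))" unfolding of_nat_sum[symmetric] of_nat_le_iff .
    then have total: "c * n ^ Suc m \<le> (\<Sum>x\<in>V. real (card (F x)))" using A(2) by (simp add: n_def)
    define H where "H = {x \<in> V. c / 2 * n ^ m \<le> real (card (F x))}"
    have finH: "finite H" using fin by (simp add: H_def)
    have "(\<Sum>x\<in>V. real (card (F x))) \<le> (\<Sum>x\<in>V. (if x \<in> H then n ^ m else 0) + c / 2 * n ^ m)"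
      using F_le Suc.prems n0 by (intro sum_mono) (auto simp: H_def intro: add_increasing2)
    also have "\<dots> = real (card H) * n ^ m + n * (c / 2 * n ^ m)"
    proof -
      have "V \<inter> {x. x \<in> H} = H" by (auto simp: H_def)
      then show ?thesis using fin by (simp add: sum.distrib sum.If_cases n_def)
    qed
    finally have "c * n ^ Suc m \<le> real (card H) * n ^ m + n * (c / 2 * n ^ m)" using total by simp
    then have "(c / 2 * n) * n ^ m \<le> real (card H) * n ^ m" by (simp add: algebra_simps)
    then have "c / 2 * n \<le> real (card H)" using n0 by simp
    then have "u \<le> card H" using nu by simp
    then obtain U where U: "U \<subseteq> H" "card U = u" using obtain_subset_with_card_n by metis
    have finU: "finite U" using U finH finite_subset by blast
    define D where "D y = {x \<in> U. y \<in> F x}" for y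
    define Y where "Y = {y \<in> ?X. t \<le> card (D y)}"
    have finY: "finite Y" using finX by (simp add: Y_def)
    have "real u * (c / 2 * n ^ m) \<le> (\<Sum>x\<in>U. real (card (F x)))"
      using U sum_bounded_below[of U "c / 2 * n ^ m" "\<lambda>x. real (card (F x))"] by (auto simp: H_def)
    also have "\<dots> = (\<Sum>x\<in>U. \<Sum>y\<in>?X. of_bool (y \<in> F x))"
    proof (rule sum.cong[OF refl])
      fix x
      have "?X \<inter> {y. y \<in> F x} = F x" by (auto simp: F_def)
      then show "real (card (F x)) = (\<Sum>y\<in>?X. of_bool (y \<in> F x))" using finX by simp
    qed
    also have "\<dots> = (\<Sum>y\<in>?X. \<Sum>x\<in>U. of_bool (y \<in> F x))" by (rule sum.swap)
    also have "\<dots> = (\<Sum>y\<in>?X. real (card (D y)))"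
      using finU by (intro sum.cong) (auto simp: D_def Int_def)
    also have "\<dots> \<le> (\<Sum>y\<in>?X. (if y \<in> Y then real u else 0) + real t)"
    proof (rule sum_mono)
      fix y assume y: "y \<in> ?X"
      have "card (D y) \<le> u" unfolding U(2)[symmetric] using finU by (intro card_mono) (auto simp: D_def)
      then show "real (card (D y)) \<le> (if y \<in> Y then real u else 0) + real t"
        using y by (auto simp: Y_def)
    qed
    also have "\<dots> = real (card Y) * real u + n ^ m * real t"
    proof -
      have "?X \<inter> {y. y \<in> Y} = Y" by (auto simp: Y_def)
      then show ?thesis using finX cX by (simp add: sum.distrib sum.If_cases)
    qed
    finally have "real u * (c / 2 * n ^ m) \<le> real (card Y) * real u + n ^ m * real t" .
    moreover have "n ^ m * real t \<le> real u * (c / 4 * n ^ m)"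
      using mult_left_mono[OF u(1), of "n ^ m"] n0 by (simp add: algebra_simps)
    ultimately have "real u * (c / 4 * n ^ m) \<le> real u * real (card Y)" by (simp add: algebra_simps)
    then have cY: "c / 4 * n ^ m \<le> real (card Y)" using u(2) by simp
    have "\<exists>T. T \<subseteq> D y \<and> card T = t" if "y \<in> Y" for y
    proof -
      have "t \<le> card (D y)" using that by (simp add: Y_def)
      then obtain T where "T \<subseteq> D y" "card T = t" by (rule obtain_subset_with_card_n)
      then show ?thesis by blast
    qed
    then have "\<forall>y\<in>Y. \<exists>T. T \<subseteq> D y \<and> card T = t" by (rule ballI)
    from bchoice[OF this] obtain T where "\<forall>y\<in>Y. T y \<subseteq> D y \<and> card (T y) = t" ..
    then have T: "T y \<subseteq> D y \<and> card (T y) = t" if "y \<in> Y" for y using that by (rule bspec)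
    have TU: "T y \<in> Pow U" if "y \<in> Y" for y using T[OF that] by (auto simp: D_def)
    obtain T0 where "real (card Y) \<le> real (card (Pow U)) * real (card {y \<in> Y. T y = T0})"
      using pigeonhole_relation[of Y "Pow U" "\<lambda>y T0. T y = T0"] finY finU TU by blast
    then have T0: "c' * n ^ m \<le> real (card {y \<in> Y. T y = T0})"
      using cY U(2) finU by (simp add: card_Pow c'_def field_simps)
    let ?A' = "{y \<in> Y. T y = T0}"
    have "0 < c' * n ^ m" using \<open>0 < c'\<close> n0 by simp
    then have "?A' \<noteq> {}" using T0 by (metis card.empty not_less of_nat_0)
    then obtain y0 where "y0 \<in> Y" "T y0 = T0" by blast
    then have T0t: "card T0 = t" "T0 \<subseteq> V" using T[of y0] TU[of y0] U by (auto simp: H_def)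
    have "\<exists>W. (\<forall>i<m. W i \<subseteq> V \<and> card (W i) = t) \<and> PiE {..<m} W \<subseteq> ?A'"
      using N[OF fin, of ?A'] big T0 by (auto simp: Y_def n_def)
    then obtain W where W: "\<And>i. i < m \<Longrightarrow> W i \<subseteq> V \<and> card (W i) = t" "PiE {..<m} W \<subseteq> ?A'" by blast
    let ?W = "W(m := T0)"
    have "PiE {..<Suc m} ?W \<subseteq> A"
    proof
      fix f assume f: "f \<in> PiE {..<Suc m} ?W"
      have fi: "f i \<in> ?W i" if "i < Suc m" for i using f that by (auto simp: PiE_def Pi_def)
      have "restrict f {..<m} \<in> PiE {..<m} W"
      proof (rule PiE_I)
        fix i assume "i \<in> {..<m}"
        then show "restrict f {..<m} i \<in> W i" using fi[of i] by simp
      qed auto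
      then have y: "restrict f {..<m} \<in> ?A'" using W(2) by blast
      then have "f m \<in> D (restrict f {..<m})" using T[of "restrict f {..<m}"] fi[of m] by auto
      then have "(restrict f {..<m})(m := f m) \<in> A" by (simp add: D_def F_def)
      moreover have "(restrict f {..<m})(m := f m) = f"
      proof
        fix i
        show "((restrict f {..<m})(m := f m)) i = f i"
          using PiE_arb[OF f, of i] by (cases i m rule: linorder_cases) auto
      qed
      ultimately show "f \<in> A" by simp
    qed
    moreover have "\<forall>i<Suc m. ?W i \<subseteq> V \<and> card (?W i) = t" using W(1) T0t by (auto simp: less_Suc_eq)
    ultimately show "\<exists>W. (\<forall>i<Suc m. W i \<subseteq> V \<and> card (W i) = t) \<and> PiE {..<Suc m} W \<subseteq> A" by blast
  qed
qed

section \<open>The limit exists\<close>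

definition pullback :: "nat \<Rightarrow> nat \<Rightarrow> (nat \<Rightarrow> 'a) \<Rightarrow> 'a set set \<Rightarrow> nat set set" where
  "pullback k m f E = {e. e \<subseteq> {..<m} \<and> card e = k \<and> f ` e \<in> E}"

lemma neighbours_in_pullback:
  assumes unif: "\<And>e. e \<in> E \<Longrightarrow> card e = k" and k: "1 \<le> k"
    and f: "inj_on f {..<m}" and S: "S \<subseteq> {..<m}" "card S = k - 1"
  shows "{i \<in> {..<m}. insert i S \<in> pullback k m f E} = {i \<in> {..<m}. insert (f i) (f ` S) \<in> E}"
proof -
  have finS: "finite S" using S finite_subset by blast
  have "card (insert i S) = k" if "i < m" "insert (f i) (f ` S) \<in> E" for i
  proof -
    have "inj_on f (insert i S)" using f by (rule inj_on_subset) (use S that in auto)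
    then have "card (f ` insert i S) = card (insert i S)" by (rule card_image)
    then show ?thesis using unif[OF that(2)] by simp
  qed
  then show ?thesis using S by (auto simp: pullback_def)
qed

lemma min_codegree_le_codegree:
  assumes "uniform_hypergraph k G" "S \<subseteq> verts G" "card S = k - 1"
  shows "min_codegree k G \<le> codegree G S"
  unfolding min_codegree_def using assms by (intro Min_le) (auto simp: uniform_hypergraph_def)

lemma min_codegree_geI:
  assumes G: "uniform_hypergraph k G" "k - 1 \<le> card (verts G)"
    and d: "\<And>S. S \<subseteq> verts G \<Longrightarrow> card S = k - 1 \<Longrightarrow> d \<le> real (codegree G S)"
  shows "d \<le> real (min_codegree k G)"
proof -
  let ?C = "codegree G ` {S. S \<subseteq> verts G \<and> card S = k - 1}"
  obtain S where "S \<subseteq> verts G" "card S = k - 1" using obtain_subset_with_card_n[OF G(2)] by metis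
  then have "?C \<noteq> {}" by blast
  moreover have "finite ?C" using G by (simp add: uniform_hypergraph_def)
  ultimately have "Min ?C \<in> ?C" by (intro Min_in)
  then show ?thesis using d unfolding min_codegree_def by fastforce
qed

lemma codegree_le_card: "uniform_hypergraph k G \<Longrightarrow> codegree G S \<le> card (verts G)"
  unfolding codegree_def uniform_hypergraph_def by (intro card_mono) auto

context
  fixes k :: nat and F :: "'b hypergraph"
  assumes k: "1 \<le> k" and F: "edges F \<noteq> {}"
begin

lemma ex_codegree_attained:
  assumes "k - 1 \<le> n"
  shows "\<exists>G :: nat hypergraph. uniform_hypergraph k G \<and> card (verts G) = n \<and> \<not> contains_copy G F \<and>
    min_codegree k G = ex_codegree k n F"
proof -
  let ?A = "{min_codegree k G | G :: nat hypergraph.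
            uniform_hypergraph k G \<and> card (verts G) = n \<and> \<not> contains_copy G F}"
  have "Max ?A \<in> ?A"
    using finite_min_codegrees[OF k assms F] min_codegrees_nonempty[OF k assms F] by (rule Max_in)
  then have "ex_codegree k n F \<in> ?A" unfolding ex_codegree_def .
  then obtain G :: "nat hypergraph" where "ex_codegree k n F = min_codegree k G"
    "uniform_hypergraph k G \<and> card (verts G) = n \<and> \<not> contains_copy G F"
    unfolding mem_Collect_eq by (elim exE conjE) (rule that, assumption, intro conjI)
  then show ?thesis by (intro exI[of _ G]) simp
qed

lemma min_codegree_le_ex_codegree:
  fixes G :: "nat hypergraph"
  assumes "k - 1 \<le> n" "uniform_hypergraph k G" "card (verts G) = n" "\<not> contains_copy G F"
  shows "min_codegree k G \<le> ex_codegree k n F"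
  unfolding ex_codegree_def
  by (rule Max_ge[OF finite_min_codegrees[OF k assms(1) F]]) (use assms in blast)

lemma ex_codegree_le:
  assumes "k - 1 \<le> n" shows "ex_codegree k n F \<le> n"
proof -
  obtain G :: "nat hypergraph" where G: "uniform_hypergraph k G" "card (verts G) = n"
    "min_codegree k G = ex_codegree k n F"
    using ex_codegree_attained[OF assms] by blast
  have "k - 1 \<le> card (verts G)" using G(2) assms by simp
  then obtain S where S: "S \<subseteq> verts G" "card S = k - 1" by (rule obtain_subset_with_card_n)
  show ?thesis
    using min_codegree_le_codegree[OF G(1) S] codegree_le_card[OF G(1), of S] G(2,3) by linarith
qed

text \<open>A free hypergraph on \<open>n\<close> vertices with the extremal codegree has a sample of \<open>m\<close> vertices that
  is again free and has almost the same relative codegree.\<close>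

lemma codegree_density_almost_decreasing:
  assumes \<epsilon>: "0 < \<epsilon>" "\<epsilon> \<le> 1"
  shows "\<exists>M. \<forall>m\<ge>M. \<exists>N. \<forall>n\<ge>N.
    real (ex_codegree k n F) / real n \<le> real (ex_codegree k m F) / real m + \<epsilon>"
proof -
  obtain M where M: "\<forall>m (V :: nat set) E \<gamma>. M \<le> m \<longrightarrow> finite V \<longrightarrow> 4 * m\<^sup>2 \<le> card V \<longrightarrow> 0 \<le> \<gamma> \<longrightarrow> \<gamma> \<le> 1 \<longrightarrow>
     (\<forall>S\<subseteq>V. card S = k - 1 \<longrightarrow> \<gamma> * real (card V) \<le> real (card {w \<in> V. insert w S \<in> E})) \<longrightarrow>
     real (card V) ^ m \<le> 2 * real (card {f \<in> PiE {..<m} (\<lambda>_. V). inj_on f {..<m} \<and>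
        (\<forall>S\<subseteq>{..<m}. card S = k - 1 \<longrightarrow> (\<gamma> - \<epsilon>) * real m \<le> real (card {i \<in> {..<m}. insert (f i) (f ` S) \<in> E}))})"
    using most_samples_keep_codegree[OF \<epsilon>, of "k - 1", where 'a = nat] ..
  show ?thesis
  proof (rule exI[of _ "max M k"], intro allI impI)
    fix m assume m: "max M k \<le> m"
    show "\<exists>N. \<forall>n\<ge>N. real (ex_codegree k n F) / real n \<le> real (ex_codegree k m F) / real m + \<epsilon>"
    proof (intro exI[of _ "max k (4 * m\<^sup>2)"] allI impI)
      fix n assume n: "max k (4 * m\<^sup>2) \<le> n"
      have km: "k - 1 \<le> m" using m by linarith
      have "k - 1 \<le> n" using n by linarith
      then obtain G0 :: "nat hypergraph" where G0: "uniform_hypergraph k G0" "card (verts G0) = n"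
        "\<not> contains_copy G0 F" "min_codegree k G0 = ex_codegree k n F"
        using ex_codegree_attained by blast
      obtain V E where VE: "G0 = (V, E)" by (cases G0)
      note G = G0[unfolded VE fst_conv]
      have fin: "finite V" and unif: "\<And>e. e \<in> E \<Longrightarrow> card e = k"
        using G(1) by (auto simp: uniform_hypergraph_def)
      define \<gamma> where "\<gamma> = real (ex_codegree k n F) / real n"
      have n0: "0 < n" using n k by simp
      have \<gamma>: "0 \<le> \<gamma>" "\<gamma> \<le> 1" using ex_codegree_le[of n] n n0 by (auto simp: \<gamma>_def)
      have codeg: "\<forall>S\<subseteq>V. card S = k - 1 \<longrightarrow> \<gamma> * real (card V) \<le> real (card {w \<in> V. insert w S \<in> E})"
      proof (intro allI impI)
        fix S assume "S \<subseteq> V" "card S = k - 1"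
        then have "ex_codegree k n F \<le> codegree (V, E) S"
          using min_codegree_le_codegree[OF G(1), of S] G(4) by simp
        then show "\<gamma> * real (card V) \<le> real (card {w \<in> V. insert w S \<in> E})"
          using n0 G(2) by (simp add: \<gamma>_def codegree_def)
      qed
      let ?Good = "{f \<in> PiE {..<m} (\<lambda>_. V). inj_on f {..<m} \<and>
        (\<forall>S\<subseteq>{..<m}. card S = k - 1 \<longrightarrow> (\<gamma> - \<epsilon>) * real m \<le> real (card {i \<in> {..<m}. insert (f i) (f ` S) \<in> E}))}"
      have "real (card V) ^ m \<le> 2 * real (card ?Good)"
        using m n G(2) by (intro M[THEN spec, THEN spec, THEN spec, THEN spec, THEN mp, THEN mp, THEN mp, THEN mp, THEN mp, THEN mp, OF _ fin _ \<gamma> codeg]) auto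
      moreover have "0 < real (card V) ^ m" using n0 G(2) by simp
      ultimately have "0 < card ?Good" by linarith
      then have "\<exists>f. f \<in> ?Good" unfolding card_gt_0_iff ex_in_conv by (rule conjunct1)
      then obtain f where "f \<in> ?Good" ..
      then have f: "f \<in> PiE {..<m} (\<lambda>_. V)" "inj_on f {..<m}"
        "\<And>S. S \<subseteq> {..<m} \<Longrightarrow> card S = k - 1 \<Longrightarrow>
           (\<gamma> - \<epsilon>) * real m \<le> real (card {i \<in> {..<m}. insert (f i) (f ` S) \<in> E})"
        by blast+
      let ?H = "({..<m}, pullback k m f E)"
      have H: "uniform_hypergraph k ?H" by (auto simp: uniform_hypergraph_def pullback_def)
      have free: "\<not> contains_copy ?H F"
      proof
        assume "contains_copy ?H F"
        then obtain h where h: "inj_on h (verts F)" "h ` verts F \<subseteq> {..<m}"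
          "\<And>e. e \<in> edges F \<Longrightarrow> h ` e \<in> pullback k m f E"
          by (auto simp: contains_copy_def)
        have "inj_on (f \<circ> h) (verts F)"
          by (rule comp_inj_on[OF h(1)]) (rule inj_on_subset[OF f(2) h(2)])
        moreover have "(f \<circ> h) ` verts F \<subseteq> V" using f(1) h(2) by auto
        moreover have "(f \<circ> h) ` e \<in> E" if "e \<in> edges F" for e
          using h(3)[OF that] by (simp add: pullback_def image_comp)
        ultimately have "contains_copy (V, E) F"
          unfolding contains_copy_def fst_conv snd_conv by (intro exI[of _ "f \<circ> h"] conjI ballI)
        then show False using G(3) by contradiction
      qed
      have "(\<gamma> - \<epsilon>) * real m \<le> real (min_codegree k ?H)"
      proof (rule min_codegree_geI[OF H])
        show "k - 1 \<le> card (verts ?H)" using km by simp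
        fix S assume "S \<subseteq> verts ?H" and cS: "card S = k - 1"
        then have S: "S \<subseteq> {..<m}" by simp
        show "(\<gamma> - \<epsilon>) * real m \<le> real (codegree ?H S)"
          using f(3)[OF S cS] neighbours_in_pullback[OF unif k f(2) S cS] by (simp add: codegree_def)
      qed
      also have "\<dots> \<le> real (ex_codegree k m F)"
        using min_codegree_le_ex_codegree[OF km H _ free] by simp
      finally have "(\<gamma> - \<epsilon>) * real m \<le> real (ex_codegree k m F)" .
      moreover have "0 < real m" using m k by simp
      ultimately have "\<gamma> - \<epsilon> \<le> real (ex_codegree k m F) / real m" by (simp add: pos_le_divide_eq)
      then show "real (ex_codegree k n F) / real n \<le> real (ex_codegree k m F) / real m + \<epsilon>"
        by (simp add: \<gamma>_def)
    qed
  qed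
qed

end

text \<open>The limit is the limes superior, written as the infimum of all eventual upper bounds: each \<open>a m\<close>
  with \<open>m\<close> large, plus \<open>\<epsilon>\<close>, is such a bound.\<close>

lemma convergent_if_almost_decreasing:
  fixes a :: "nat \<Rightarrow> real"
  assumes bounds: "\<And>n. b \<le> a n" "\<And>n. n0 \<le> n \<Longrightarrow> a n \<le> c"
    and dec: "\<And>\<epsilon>. 0 < \<epsilon> \<Longrightarrow> \<epsilon> \<le> 1 \<Longrightarrow> \<exists>M. \<forall>m\<ge>M. \<exists>N. \<forall>n\<ge>N. a n \<le> a m + \<epsilon>"
  shows "convergent a"
proof -
  define X where "X = {x. \<exists>N. \<forall>n\<ge>N. a n \<le> x}"
  have ne: "X \<noteq> {}" using bounds(2) by (auto simp: X_def)
  have bdd: "bdd_below X"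
  proof (rule bdd_belowI)
    fix x assume "x \<in> X"
    then obtain N where "a N \<le> x" by (auto simp: X_def)
    then show "b \<le> x" using bounds(1)[of N] by simp
  qed
  have "a \<longlonglongrightarrow> Inf X"
  proof (rule LIMSEQ_I)
    fix r :: real assume r: "0 < r"
    define \<epsilon> where "\<epsilon> = min (r / 2) 1"
    have \<epsilon>: "0 < \<epsilon>" "\<epsilon> \<le> 1" "\<epsilon> < r" using r by (auto simp: \<epsilon>_def)
    have "\<exists>x\<in>X. x < Inf X + r" using cInf_lessD[OF ne, of "Inf X + r"] r by simp
    then obtain x N1 where x: "x < Inf X + r" "\<And>n. N1 \<le> n \<Longrightarrow> a n \<le> x" by (auto simp: X_def)
    obtain M where M: "\<And>m. M \<le> m \<Longrightarrow> \<exists>N. \<forall>n\<ge>N. a n \<le> a m + \<epsilon>" using dec[OF \<epsilon>(1,2)] by blast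
    have "norm (a n - Inf X) < r" if n: "max N1 M \<le> n" for n
    proof -
      have "a n < Inf X + r" using x(1) x(2)[of n] n by simp
      moreover have "a n + \<epsilon> \<in> X" using M[of n] n by (auto simp: X_def)
      then have "Inf X \<le> a n + \<epsilon>" using bdd by (rule cInf_lower)
      ultimately show ?thesis using \<epsilon>(3) by (simp add: abs_less_iff)
    qed
    then show "\<exists>no. \<forall>n\<ge>no. norm (a n - Inf X) < r" by blast
  qed
  then show ?thesis by (rule convergentI)
qed

section \<open>From closed walks to tight cycles\<close>

text \<open>A closed walk may repeat vertices, but two visits of \<open>x\<close> can use different vertices of \<open>W x\<close>:
  the \<open>i\<close>-th vertex of the cycle is the \<open>i\<close>-th element of \<open>W (\<phi> i)\<close>. Within a window of \<open>k\<close>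
  steps no vertex is repeated, so some function in the box makes exactly these choices there. The
  sets \<open>W x\<close> are disjoint because all functions in the box are injective.\<close>

lemma copy_of_cycle_in_box:
  assumes V: "V \<noteq> {}" and kl: "0 < k" "k < l"
    and \<phi>: "\<phi> ` {..<l} \<subseteq> {..<m}"
    and W: "\<And>x. x < m \<Longrightarrow> W x \<subseteq> V \<and> card (W x) = l"
    and box: "\<And>f. f \<in> PiE {..<m} W \<Longrightarrow> inj_on f {..<m} \<and>
       (\<forall>i<l. (\<lambda>j. \<phi> ((i + j) mod l)) ` {..<k} \<in> pullback k m f E)"
  shows "contains_copy (V, E) (tight_cycle k l)"
proof -
  have "\<exists>w. bij_betw w {..<l} (W x)" if "x < m" for x
  proof -
    have "finite (W x)" using W[OF that] kl by (auto intro: card_ge_0_finite)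
    then show ?thesis using W[OF that] by (intro finite_same_card_bij) auto
  qed
  then have "\<forall>x\<in>{..<m}. \<exists>w. bij_betw w {..<l} (W x)" by simp
  from bchoice[OF this] obtain w where w: "\<forall>x\<in>{..<m}. bij_betw (w x) {..<l} (W x)" ..
  have wW: "w x i \<in> W x" if "x < m" "i < l" for x i
    using bij_betwE[OF bspec[OF w]] that by simp
  have w_inj: "i = j" if "x < m" "i < l" "j < l" "w x i = w x j" for x i j
    using bij_betw_imp_inj_on[OF bspec[OF w]] that by (auto dest: inj_onD)
  have \<phi>m: "\<phi> i < m" if "i < l" for i using \<phi> that by auto
  define h where "h i = w (\<phi> i) i" for i
  have choice: "restrict (\<lambda>x. w x (g x)) {..<m} \<in> PiE {..<m} W" if "\<And>x. g x < l" for g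
    by (rule PiE_I) (use wW that in auto)
  have "inj_on h {..<l}"
  proof (rule inj_onI)
    fix i j assume ij: "i \<in> {..<l}" "j \<in> {..<l}" "h i = h j"
    show "i = j"
    proof (cases "\<phi> i = \<phi> j")
      case True
      then show ?thesis using w_inj[of "\<phi> i" i j] \<phi>m ij by (simp add: h_def)
    next
      case False
      define g where "g x = (if x = \<phi> i then i else j)" for x
      let ?f = "restrict (\<lambda>x. w x (g x)) {..<m}"
      have "?f \<in> PiE {..<m} W" using ij by (intro choice) (auto simp: g_def)
      from box[OF this] have "inj_on ?f {..<m}" by (rule conjunct1)
      moreover have "?f (\<phi> i) = ?f (\<phi> j)" using False ij \<phi>m by (simp add: h_def g_def)
      ultimately have "\<phi> i = \<phi> j" using \<phi>m ij by (auto dest: inj_onD)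
      then show ?thesis using False by contradiction
    qed
  qed
  moreover have "h ` {..<l} \<subseteq> V"
  proof (rule image_subsetI)
    fix i assume "i \<in> {..<l}"
    then have i: "i < l" by simp
    have "h i \<in> W (\<phi> i)" unfolding h_def by (rule wW[OF \<phi>m[OF i] i])
    then show "h i \<in> V" using W[OF \<phi>m[OF i]] by blast
  qed
  moreover have "h ` (\<lambda>j. (i + j) mod l) ` {..<k} \<in> E" if i: "i < l" for i
  proof -
    let ?idx = "\<lambda>j. (i + j) mod l"
    have idx: "?idx j < l" for j using kl by simp
    let ?\<psi> = "\<lambda>j. \<phi> (?idx j)"
    define g where "g x = ?idx (inv_into {..<k} ?\<psi> x)" for x
    let ?f = "restrict (\<lambda>x. w x (g x)) {..<m}"
    have "?f \<in> PiE {..<m} W" using idx by (intro choice) (simp add: g_def)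
    from box[OF this, THEN conjunct2, rule_format, OF i] have e: "?\<psi> ` {..<k} \<in> pullback k m ?f E" .
    then have "card (?\<psi> ` {..<k}) = card {..<k}" by (simp add: pullback_def)
    then have inj: "inj_on ?\<psi> {..<k}" by (intro eq_card_imp_inj_on) auto
    have "?f (?\<psi> j) = h (?idx j)" if "j \<in> {..<k}" for j
    proof -
      have "g (?\<psi> j) = ?idx j" unfolding g_def using inv_into_f_f[OF inj that] by simp
      then show ?thesis using \<phi>m[OF idx] by (simp add: h_def)
    qed
    then have "?f ` ?\<psi> ` {..<k} = h ` ?idx ` {..<k}" unfolding image_image by (intro image_cong refl)
    moreover have "?f ` ?\<psi> ` {..<k} \<in> E" using e unfolding pullback_def by blast
    ultimately show ?thesis by (simp only:)
  qed
  ultimately show ?thesis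
    unfolding contains_copy_def tight_cycle_def fst_conv snd_conv by (intro exI[of _ h] conjI ballI) auto
qed

text \<open>In a free host above the bound, at least half of all samples of \<open>m\<close> vertices have codegree above
  \<open>m / 3\<close> and hence contain a closed walk. There are at most \<open>m ^ l\<close> walks, so one walk \<open>\<phi>\<close> serves a
  positive proportion \<open>c\<close> of all samples. A box of such samples contains the cycle.\<close>

lemma ex_codegree_tight_cycle_upper:
  assumes k: "3 \<le> k" and kl: "k < l" "20 * k ^ 2 \<le> l" and odd: "odd (k div gcd k l)"
    and \<epsilon>: "0 < \<epsilon>" "\<epsilon> \<le> 1 / 3"
  shows "\<exists>N. \<forall>n\<ge>N. real (ex_codegree k n (tight_cycle k l)) / real n \<le> 1 / 3 + 2 * \<epsilon>"
proof -
  have k1: "1 \<le> k" using k by simp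
  have F: "edges (tight_cycle k l) \<noteq> {}" using kl by (auto simp: tight_cycle_def lessThan_empty_iff)
  define \<gamma> where "\<gamma> = 1 / 3 + 2 * \<epsilon>"
  have \<gamma>: "0 \<le> \<gamma>" "\<gamma> \<le> 1" using \<epsilon> by (auto simp: \<gamma>_def)
  have \<epsilon>1: "\<epsilon> \<le> 1" using \<epsilon> by simp
  obtain M where M: "\<forall>m (V :: nat set) E \<gamma>. M \<le> m \<longrightarrow> finite V \<longrightarrow> 4 * m\<^sup>2 \<le> card V \<longrightarrow> 0 \<le> \<gamma> \<longrightarrow> \<gamma> \<le> 1 \<longrightarrow>
     (\<forall>S\<subseteq>V. card S = k - 1 \<longrightarrow> \<gamma> * real (card V) \<le> real (card {w \<in> V. insert w S \<in> E})) \<longrightarrow>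
     real (card V) ^ m \<le> 2 * real (card {f \<in> PiE {..<m} (\<lambda>_. V). inj_on f {..<m} \<and>
        (\<forall>S\<subseteq>{..<m}. card S = k - 1 \<longrightarrow> (\<gamma> - \<epsilon>) * real m \<le> real (card {i \<in> {..<m}. insert (f i) (f ` S) \<in> E}))})"
    using most_samples_keep_codegree[OF \<epsilon>(1) \<epsilon>1, of "k - 1", where 'a = nat] ..
  define m where "m = max M k"
  have m: "M \<le> m" "k \<le> m" by (auto simp: m_def)
  define c where "c = 1 / (2 * real m ^ l)"
  have c: "0 < c" using m k1 by (simp add: c_def)
  obtain N where N: "\<forall>(V :: nat set) A. finite V \<longrightarrow> N \<le> card V \<longrightarrow> A \<subseteq> PiE {..<m} (\<lambda>_. V) \<longrightarrow>
     c * real (card V) ^ m \<le> real (card A) \<longrightarrow>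
     (\<exists>W. (\<forall>i<m. W i \<subseteq> V \<and> card (W i) = l) \<and> PiE {..<m} W \<subseteq> A)"
    using dense_set_of_functions_contains_box[OF c, of m l, where 'a = nat] ..
  show ?thesis
  proof (intro exI[of _ "max k (max N (4 * m\<^sup>2))"] allI impI)
    fix n assume n: "max k (max N (4 * m\<^sup>2)) \<le> n"
    have "k - 1 \<le> n" using n by linarith
    then obtain G0 :: "nat hypergraph" where G0: "uniform_hypergraph k G0" "card (verts G0) = n"
      "\<not> contains_copy G0 (tight_cycle k l)" "min_codegree k G0 = ex_codegree k n (tight_cycle k l)"
      using ex_codegree_attained[OF k1 F] by blast
    obtain V E where VE: "G0 = (V, E)" by (cases G0)
    note G = G0[unfolded VE fst_conv]
    have fin: "finite V" and unif: "\<And>e. e \<in> E \<Longrightarrow> card e = k"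
      using G(1) by (auto simp: uniform_hypergraph_def)
    have n0: "0 < n" using n k1 by simp
    show "real (ex_codegree k n (tight_cycle k l)) / real n \<le> 1 / 3 + 2 * \<epsilon>"
    proof (rule ccontr)
      assume "\<not> ?thesis"
      then have large: "\<gamma> * real n \<le> real (ex_codegree k n (tight_cycle k l))"
        using n0 by (simp add: \<gamma>_def field_simps)
      have codeg: "\<forall>S\<subseteq>V. card S = k - 1 \<longrightarrow> \<gamma> * real (card V) \<le> real (card {w \<in> V. insert w S \<in> E})"
      proof (intro allI impI)
        fix S assume "S \<subseteq> V" "card S = k - 1"
        then have "ex_codegree k n (tight_cycle k l) \<le> codegree (V, E) S"
          using min_codegree_le_codegree[OF G(1), of S] G(4) by simp
        then show "\<gamma> * real (card V) \<le> real (card {w \<in> V. insert w S \<in> E})"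
          using large G(2) by (simp add: codegree_def)
      qed
      define Good where "Good = {f \<in> PiE {..<m} (\<lambda>_. V). inj_on f {..<m} \<and>
        (\<forall>S\<subseteq>{..<m}. card S = k - 1 \<longrightarrow> (\<gamma> - \<epsilon>) * real m \<le> real (card {i \<in> {..<m}. insert (f i) (f ` S) \<in> E}))}"
      have Good: "real (card V) ^ m \<le> 2 * real (card Good)"
        unfolding Good_def using n G(2) by (intro M[THEN spec, THEN spec, THEN spec, THEN spec, THEN mp, THEN mp, THEN mp, THEN mp, THEN mp, THEN mp, OF m(1) fin _ \<gamma> codeg]) auto
      let ?\<Phi> = "PiE {..<l} (\<lambda>_. {..<m})"
      define walks where "walks f \<phi> \<longleftrightarrow> (\<forall>i<l. (\<lambda>j. \<phi> ((i + j) mod l)) ` {..<k} \<in> pullback k m f E)" for f \<phi>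
      have "\<exists>\<phi>\<in>?\<Phi>. walks f \<phi>" if f: "f \<in> Good" for f
      proof -
        have inj: "inj_on f {..<m}" using f by (simp add: Good_def)
        interpret H: dense_family "pullback k m f E" k "{..<m}"
        proof
          fix S assume S: "S \<subseteq> {..<m}" "card S = k - 1"
          have "(\<gamma> - \<epsilon>) * real m \<le> real (card {i \<in> {..<m}. insert i S \<in> pullback k m f E})"
            using f S neighbours_in_pullback[OF unif k1 inj S] by (simp add: Good_def)
          moreover have "real m < 3 * ((\<gamma> - \<epsilon>) * real m)"
            using \<epsilon> m k1 by (simp add: \<gamma>_def algebra_simps)
          ultimately have "real m < real (3 * card {i \<in> {..<m}. insert i S \<in> pullback k m f E})"
            by simp
          then show "card {..<m} < 3 * card {w \<in> {..<m}. insert w S \<in> pullback k m f E}"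
            by (simp only: of_nat_less_iff card_lessThan)
        qed (use k in \<open>auto simp: pullback_def\<close>)
        have "k - 1 \<le> card {..<m}" using m by simp
        then obtain \<phi> where \<phi>: "H.closed_tight_walk l \<phi>" "\<phi> ` {..<l} \<subseteq> {..<m}"
          using H.closed_tight_walk_exists[OF _ kl odd] by blast
        have "restrict \<phi> {..<l} \<in> ?\<Phi>" by (rule PiE_I) (use \<phi>(2) in auto)
        moreover have "walks f (restrict \<phi> {..<l})"
          using \<phi>(1) kl unfolding walks_def H.closed_tight_walk_def by auto
        ultimately show ?thesis by blast
      qed
      moreover have "finite Good"
        by (rule finite_subset[of _ "PiE {..<m} (\<lambda>_. V)"]) (use fin in \<open>auto simp: Good_def intro: finite_PiE\<close>)
      moreover have fin\<Phi>: "finite ?\<Phi>" by (intro finite_PiE) auto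
      moreover have c\<Phi>: "card ?\<Phi> = m ^ l" by (simp add: card_funcsetE)
      moreover have "?\<Phi> \<noteq> {}" using m k1 by (simp add: PiE_eq_empty_iff lessThan_empty_iff)
      ultimately obtain \<phi> where \<phi>: "\<phi> \<in> ?\<Phi>"
        "real (card Good) \<le> real (card ?\<Phi>) * real (card {f \<in> Good. walks f \<phi>})"
        using pigeonhole_relation[of Good ?\<Phi> walks] by blast
      let ?A = "{f \<in> Good. walks f \<phi>}"
      have "c * real (card V) ^ m \<le> real (card ?A)"
        using Good \<phi>(2) m k1 by (simp add: c\<Phi> c_def field_simps)
      moreover have "N \<le> card V" "?A \<subseteq> PiE {..<m} (\<lambda>_. V)" using n G(2) by (auto simp: Good_def)
      ultimately obtain W where W: "\<And>i. i < m \<Longrightarrow> W i \<subseteq> V \<and> card (W i) = l" "PiE {..<m} W \<subseteq> ?A"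
        using N[rule_format, OF fin, of ?A] by blast
      have "contains_copy (V, E) (tight_cycle k l)"
      proof (rule copy_of_cycle_in_box[OF _ _ kl(1) _ W(1)])
        show "V \<noteq> {}" using n0 G(2) by auto
        show "0 < k" using k1 by simp
        show "\<phi> ` {..<l} \<subseteq> {..<m}" using \<phi>(1) by auto
        fix f assume "f \<in> PiE {..<m} W"
        then have "f \<in> ?A" using W(2) by blast
        then show "inj_on f {..<m} \<and> (\<forall>i<l. (\<lambda>j. \<phi> ((i + j) mod l)) ` {..<k} \<in> pullback k m f E)"
          by (simp add: Good_def walks_def)
      qed
      then show False using G(3) by contradiction
    qed
  qed
qed

section \<open>The codegree Turan density of tight cycles\<close>

theorem theorem1p1:
  fixes k l :: nat
  assumes "3 \<le> k" and "k < l"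
    and "\<not> k dvd l"
    and "l \<ge> 20 * k ^ 2"
    and "\<not> 2 dvd k div gcd k l"
  shows "codegree_turan_density k (tight_cycle k l) \<le> 1 / 3"
proof -
  let ?F = "tight_cycle k l"
  define a where "a = (\<lambda>n. real (ex_codegree k n ?F) / real n)"
  have k1: "1 \<le> k" using assms by simp
  have F: "edges ?F \<noteq> {}" using assms(2) by (auto simp: tight_cycle_def lessThan_empty_iff)
  have "convergent a"
  proof (rule convergent_if_almost_decreasing[of 0 a k 1])
    show "0 \<le> a n" for n by (simp add: a_def)
    show "a n \<le> 1" if "k \<le> n" for n
      using ex_codegree_le[OF k1 F, of n] that k1 by (simp add: a_def)
    show "\<exists>M. \<forall>m\<ge>M. \<exists>N. \<forall>n\<ge>N. a n \<le> a m + \<epsilon>" if "0 < \<epsilon>" "\<epsilon> \<le> 1" for \<epsilon>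
      using codegree_density_almost_decreasing[OF k1 F that] by (simp add: a_def)
  qed
  then have lim: "a \<longlonglongrightarrow> lim a" by (simp add: convergent_LIMSEQ_iff)
  have "lim a \<le> 1 / 3 + e" if e: "0 < e" for e
  proof -
    define \<epsilon> where "\<epsilon> = min (e / 2) (1 / 3)"
    have \<epsilon>: "0 < \<epsilon>" "\<epsilon> \<le> 1 / 3" "2 * \<epsilon> \<le> e" using e by (auto simp: \<epsilon>_def)
    obtain N where "\<And>n. N \<le> n \<Longrightarrow> a n \<le> 1 / 3 + 2 * \<epsilon>"
      using ex_codegree_tight_cycle_upper[OF assms(1,2,4,5) \<epsilon>(1,2)] unfolding a_def by blast
    then have "lim a \<le> 1 / 3 + 2 * \<epsilon>" by (intro LIMSEQ_le_const2[OF lim]) blast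
    then show ?thesis using \<epsilon>(3) by simp
  qed
  then have "lim a \<le> 1 / 3" by (rule field_le_epsilon)
  then show ?thesis unfolding codegree_turan_density_def a_def .
qed

end
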